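(* Let $X$ be a $\sigma$-compact metrizable space. Then $\mathrm{A}(X)$ is a $G_\delta$ subset of $\operatorname{Met}(X)$. If $X$ is strongly zero-dimensional, then $\mathrm{A}(X)$ is dense in $\operatorname{Met}(X)$.
   Context: A nonempty metrizable space is strongly zero-dimensional if its covering dimension is zero, or equivalently, if its large inductive dimension is zero; the empty space is also regarded as strongly zero-dimensional. For a metrizable space $X$, $\operatorname{Met}(X)$ denotes the set of all metrics on $X$ inducing the topology of $X$. For $d,e\in\operatorname{Met}(X)$, put $\mathcal D_X(d,e)=\sup_{x,y\in X}|d(x,y)-e(x,y)|\in[0,\infty]$ (taken to be $0$ if $X$ is empty). $\operatorname{Met}(X)$ carries the uniform topology, i.e. the topology induced by the metric $\min\{1,\mathcal D_X\}$. Write $[X]^2=\{\{x,y\}\mid x,y\in X,\ x\neq y\}$. A metric $d\in\operatorname{Met}(X)$ has algebraically independent distances if, for every positive integer $r$, every choice of distinct $\{x_1,y_1\},\dots,\{x_r,y_r\}\in[X]^2$, and every nonzero polynomial $P\in\mathbb Q[T_1,\dots,T_r]$, we have $P(d(x_1,y_1),\dots,d(x_r,y_r))\neq 0$. $\mathrm{A}(X)$ denotes the set of all such metrics in $\operatorname{Met}(X)$. *)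

theory Defs
  imports "HOL-Analysis.Analysis" "HOL-Library.Poly_Mapping"
begin

definition sigma_compact_space :: "'a topology \<Rightarrow> bool" where
  "sigma_compact_space X \<longleftrightarrow>
     (\<exists>\<K>. countable \<K> \<and> (\<forall>K\<in>\<K>. compactin X K) \<and> \<Union>\<K> = topspace X)"

definition finite_open_cover :: "'a topology \<Rightarrow> 'a set set \<Rightarrow> bool" where
  "finite_open_cover X \<U> \<longleftrightarrow>
     finite \<U> \<and> (\<forall>U\<in>\<U>. openin X U) \<and> \<Union>\<U> = topspace X"

text \<open>Covering dimension of a normal space, via finite open covers. The bound is an integer, so
  that \<open>n = -1\<close> holds for the empty space only.\<close>

definition covering_dim_le :: "'a topology \<Rightarrow> int \<Rightarrow> bool" where
  "covering_dim_le X n \<longleftrightarrow>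
     (\<forall>\<U>. finite_open_cover X \<U> \<longrightarrow>
        (\<exists>\<V>. finite_open_cover X \<V> \<and>
             (\<forall>V\<in>\<V>. \<exists>U\<in>\<U>. V \<subseteq> U) \<and>
             (\<forall>x\<in>topspace X. int (card {V\<in>\<V>. x \<in> V}) \<le> n + 1)))"

definition has_covering_dim :: "'a topology \<Rightarrow> int \<Rightarrow> bool" where
  "has_covering_dim X n \<longleftrightarrow> covering_dim_le X n \<and> \<not> covering_dim_le X (n - 1)"

definition strongly_zero_dimensional :: "'a topology \<Rightarrow> bool" where
  "strongly_zero_dimensional X \<longleftrightarrow> topspace X = {} \<or> has_covering_dim X 0"

text \<open>A metric on \<open>topspace X\<close> is represented by a total function. Requiring it to vanish off
  \<open>topspace X\<close> makes this representation unique.\<close>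

definition Met :: "'a topology \<Rightarrow> ('a \<Rightarrow> 'a \<Rightarrow> real) set" where
  "Met X = {d. Metric_space (topspace X) d \<and>
               Metric_space.mtopology (topspace X) d = X \<and>
               (\<forall>x y. x \<notin> topspace X \<or> y \<notin> topspace X \<longrightarrow> d x y = 0)}"

definition sup_dist ::
    "'a topology \<Rightarrow> ('a \<Rightarrow> 'a \<Rightarrow> real) \<Rightarrow> ('a \<Rightarrow> 'a \<Rightarrow> real) \<Rightarrow> ennreal" where
  "sup_dist X d e = (SUP (x, y) \<in> topspace X \<times> topspace X. ennreal \<bar>d x y - e x y\<bar>)"

definition capped_sup_dist ::
    "'a topology \<Rightarrow> ('a \<Rightarrow> 'a \<Rightarrow> real) \<Rightarrow> ('a \<Rightarrow> 'a \<Rightarrow> real) \<Rightarrow> real" where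
  "capped_sup_dist X d e = enn2real (min 1 (sup_dist X d e))"

lemma sup_dist_commute: "sup_dist X d e = sup_dist X e d"
  by (simp add: sup_dist_def abs_minus_commute)

lemma sup_dist_upper:
  assumes "x \<in> topspace X" "y \<in> topspace X"
  shows "ennreal \<bar>d x y - e x y\<bar> \<le> sup_dist X d e"
  unfolding sup_dist_def using assms by (intro SUP_upper2[of "(x, y)"]) auto

lemma sup_dist_triangle: "sup_dist X d f \<le> sup_dist X d e + sup_dist X e f"
proof -
  have "ennreal \<bar>d x y - f x y\<bar> \<le> sup_dist X d e + sup_dist X e f"
    if "x \<in> topspace X" "y \<in> topspace X" for x y
  proof -
    have "ennreal \<bar>d x y - f x y\<bar> \<le> ennreal (\<bar>d x y - e x y\<bar> + \<bar>e x y - f x y\<bar>)"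
      by (intro ennreal_leI) linarith
    also have "\<dots> = ennreal \<bar>d x y - e x y\<bar> + ennreal \<bar>e x y - f x y\<bar>"
      by (simp add: ennreal_plus)
    also have "\<dots> \<le> sup_dist X d e + sup_dist X e f"
      using that by (intro add_mono sup_dist_upper)
    finally show ?thesis .
  qed
  then show ?thesis
    unfolding sup_dist_def[of X d f] by (intro SUP_least) auto
qed

lemma sup_dist_eq_0_iff:
  assumes "d \<in> Met X" "e \<in> Met X"
  shows "sup_dist X d e = 0 \<longleftrightarrow> d = e"
proof
  assume 0: "sup_dist X d e = 0"
  have "d x y = e x y" for x y
  proof (cases "x \<in> topspace X \<and> y \<in> topspace X")
    case True
    then have "ennreal \<bar>d x y - e x y\<bar> \<le> 0"
      using sup_dist_upper[of x X y d e] 0 by simp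
    then show ?thesis by (simp add: ennreal_eq_0_iff)
  next
    case False
    then show ?thesis using assms by (auto simp: Met_def)
  qed
  then show "d = e" by blast
next
  assume "d = e"
  then have "sup_dist X d e \<le> 0"
    unfolding sup_dist_def by (intro SUP_least) auto
  then show "sup_dist X d e = 0" by simp
qed

lemma Metric_space_Met: "Metric_space (Met X) (capped_sup_dist X)"
proof
  fix d e f :: "'a \<Rightarrow> 'a \<Rightarrow> real"
  have fin: "min 1 a < top" for a :: ennreal
    by (simp add: min_less_iff_disj)
  show "0 \<le> capped_sup_dist X d e"
    by (simp add: capped_sup_dist_def)
  show "capped_sup_dist X d e = capped_sup_dist X e d"
    by (simp add: capped_sup_dist_def sup_dist_commute)
  show "capped_sup_dist X d e = 0 \<longleftrightarrow> d = e" if "d \<in> Met X" "e \<in> Met X"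
  proof -
    have "capped_sup_dist X d e = 0 \<longleftrightarrow> sup_dist X d e = 0"
      using fin[of "sup_dist X d e"]
      by (auto simp: capped_sup_dist_def enn2real_eq_0_iff min_def split: if_splits)
    then show ?thesis using sup_dist_eq_0_iff[OF that] by simp
  qed
  show "capped_sup_dist X d f \<le> capped_sup_dist X d e + capped_sup_dist X e f"
  proof -
    have "min 1 (sup_dist X d f) \<le> min 1 (sup_dist X d e + sup_dist X e f)"
      by (intro min.mono sup_dist_triangle order_refl)
    also have "\<dots> \<le> min 1 (sup_dist X d e) + min 1 (sup_dist X e f)"
      by (auto simp: min_def intro: add_increasing add_increasing2)
    finally have "capped_sup_dist X d f \<le>
        enn2real (min 1 (sup_dist X d e) + min 1 (sup_dist X e f))"
      unfolding capped_sup_dist_def using fin by (intro enn2real_mono) auto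
    also have "\<dots> = capped_sup_dist X d e + capped_sup_dist X e f"
      unfolding capped_sup_dist_def using fin by (intro enn2real_plus) auto
    finally show ?thesis .
  qed
qed

definition Met_topology :: "'a topology \<Rightarrow> ('a \<Rightarrow> 'a \<Rightarrow> real) topology" where
  "Met_topology X = Metric_space.mtopology (Met X) (capped_sup_dist X)"

lemma topspace_Met_topology [simp]: "topspace (Met_topology X) = Met X"
  by (simp add: Met_topology_def Metric_space.topspace_mtopology[OF Metric_space_Met])

text \<open>A multivariate polynomial over \<open>\<rat>\<close> is a finitely supported map from monomials to
  coefficients, and a monomial is a finitely supported map from variable indices to exponents.
  The following set is \<open>\<rat>[T\<^sub>1, \<dots>, T\<^sub>r]\<close>.\<close>

type_synonym rat_mpoly = "(nat \<Rightarrow>\<^sub>0 nat) \<Rightarrow>\<^sub>0 rat"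

definition rat_mpolys :: "nat \<Rightarrow> rat_mpoly set" where
  "rat_mpolys r = {P. \<forall>m \<in> Poly_Mapping.keys P. Poly_Mapping.keys m \<subseteq> {1..r}}"

definition eval_rat_mpoly :: "nat \<Rightarrow> rat_mpoly \<Rightarrow> (nat \<Rightarrow> real) \<Rightarrow> real" where
  "eval_rat_mpoly r P t =
     (\<Sum>m \<in> Poly_Mapping.keys P.
        of_rat (Poly_Mapping.lookup P m) * (\<Prod>i = 1..r. t i ^ Poly_Mapping.lookup m i))"

definition alg_indep_distances :: "'a set \<Rightarrow> ('a \<Rightarrow> 'a \<Rightarrow> real) \<Rightarrow> bool" where
  "alg_indep_distances S d \<longleftrightarrow>
     (\<forall>r (x :: nat \<Rightarrow> 'a) y P.
        r \<ge> 1 \<longrightarrow>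
        (\<forall>i\<in>{1..r}. x i \<in> S \<and> y i \<in> S \<and> x i \<noteq> y i) \<longrightarrow>
        inj_on (\<lambda>i. {x i, y i}) {1..r} \<longrightarrow>
        P \<in> rat_mpolys r \<longrightarrow> P \<noteq> 0 \<longrightarrow>
        eval_rat_mpoly r P (\<lambda>i. d (x i) (y i)) \<noteq> 0)"

definition Met_alg_indep :: "'a topology \<Rightarrow> ('a \<Rightarrow> 'a \<Rightarrow> real) set" where
  "Met_alg_indep X = {d \<in> Met X. alg_indep_distances (topspace X) d}"

end

theory Submission
  imports Defs
begin

text \<open>For the first claim, tuples of distinct pairs of points of a \<open>\<sigma>\<close>-compact space are exhausted by
  countably many compact sets of uniformly separated tuples, and on a compact set of tuples the
  condition that a fixed polynomial does not vanish is open in the metric.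

  For density, take clopen partitions of \<open>X\<close>, each refining the previous one and with mesh tending
  to 0. Starting from the given metric evaluated at representatives of the first partition, add
  successively pseudometrics that are constant on pairs of distinct classes of the \<open>n\<close>-th partition,
  with values between \<open>t / 8\<close> and \<open>t / 4\<close>. Since there are only countably many pairs of classes, these
  values can be chosen such that the new distances between classes are algebraically independent. Only
  finitely many classes meet a compact set, so finitely many polynomial conditions on it survive
  all later perturbations once \<open>t\<close> decreases quickly enough. The limit is continuous, and it is
  bounded below on points separated by the \<open>n\<close>-th partition, so it induces the topology of \<open>X\<close>.\<close>

section \<open>Algebraically independent families of real numbers\<close>

text \<open>Formal sums and products of generators. The terms form a countable type, so the set of
  their values is countable without further argument.\<close>

datatype ring_expr = Atom nat | Plus ring_expr ring_expr | Times ring_expr ring_expr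

instance ring_expr :: countable
  by countable_datatype

primrec ring_value :: "(nat \<Rightarrow> 'a::comm_ring_1) \<Rightarrow> ring_expr \<Rightarrow> 'a" where
  "ring_value f (Atom n) = f n"
| "ring_value f (Plus a b) = ring_value f a + ring_value f b"
| "ring_value f (Times a b) = ring_value f a * ring_value f b"

text \<open>For countable \<open>S\<close> this is the closure of \<open>insert 0 S\<close> under
  addition and multiplication: with 0 added the enumerated set is nonempty, and
  \<open>from_nat_into\<close> is then onto it.\<close>

definition countable_semiring_hull :: "'a::comm_ring_1 set \<Rightarrow> 'a set" where
  "countable_semiring_hull S = range (ring_value (from_nat_into (insert 0 S)))"

lemma countable_countable_semiring_hull: "countable (countable_semiring_hull S)"
  by (simp add: countable_semiring_hull_def)

lemma countable_semiring_hull_superset: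
  assumes "countable S"
  shows "insert 0 S \<subseteq> countable_semiring_hull S"
proof
  fix a assume "a \<in> insert 0 S"
  then obtain n where "a = from_nat_into (insert 0 S) n"
    using from_nat_into_surj[of "insert 0 S" a] assms by (metis countable_insert)
  then have "a = ring_value (from_nat_into (insert 0 S)) (Atom n)"
    by simp
  then show "a \<in> countable_semiring_hull S"
    unfolding countable_semiring_hull_def by (rule range_eqI)
qed

lemma
  assumes "a \<in> countable_semiring_hull S" "b \<in> countable_semiring_hull S"
  shows countable_semiring_hull_add: "a + b \<in> countable_semiring_hull S"
    and countable_semiring_hull_mult: "a * b \<in> countable_semiring_hull S"
proof -
  let ?v = "ring_value (from_nat_into (insert 0 S))"
  obtain x y where "a = ?v x" "b = ?v y"
    using assms unfolding countable_semiring_hull_def by blast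
  then have "a + b = ?v (Plus x y)" "a * b = ?v (Times x y)"
    by simp_all
  then show "a + b \<in> countable_semiring_hull S" "a * b \<in> countable_semiring_hull S"
    unfolding countable_semiring_hull_def by blast+
qed

text \<open>A polynomial is determined by its finite list of coefficients, so only countably many
  have all coefficients in \<open>R\<close>, and each nonzero one has finitely many roots.\<close>

lemma countable_algebraic_over:
  fixes R :: "'a::idom set"
  assumes "countable R"
  shows "countable {t. \<exists>p. p \<noteq> 0 \<and> range (coeff p) \<subseteq> R \<and> poly p t = 0}"
proof -
  have "countable {p. range (coeff p) \<subseteq> R}"
  proof (rule countable_subset)
    show "{p. range (coeff p) \<subseteq> R} \<subseteq> Poly ` lists R"
    proof
      fix p assume "p \<in> {p. range (coeff p) \<subseteq> R}"
      then have "coeffs p \<in> lists R"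
        using range_coeff[of p] by auto
      then show "p \<in> Poly ` lists R"
        by (metis Poly_coeffs image_eqI)
    qed
    show "countable (Poly ` lists R)"
      using assms by auto
  qed
  then have "countable (\<Union>p\<in>{p. range (coeff p) \<subseteq> R} \<inter> {p. p \<noteq> 0}. {t. poly p t = 0})"
    by (intro countable_UN) (auto intro: countable_finite poly_roots_finite)
  then show ?thesis
    by (rule countable_subset[rotated]) auto
qed


text \<open>A finitely supported map is determined by its finite graph over the support. Rational
  polynomials thereby become countable, which permits countable intersections over them and
  numberings of them.\<close>

instance poly_mapping :: (countable, "{countable, zero}") countable
proof
  define graph where "graph P = (\<lambda>k. (k, Poly_Mapping.lookup P k)) ` Poly_Mapping.keys P"
    for P :: "'a \<Rightarrow>\<^sub>0 'b"
  have "inj graph"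
  proof (rule injI)
    fix P Q assume eq: "graph P = graph Q"
    have *: "Poly_Mapping.lookup P k = c \<longleftrightarrow> (if c = 0 then k \<notin> fst ` graph P else (k, c) \<in> graph P)"
      for P k c
      by (auto simp: graph_def in_keys_iff image_iff)
    show "P = Q"
      by (rule poly_mapping_eqI) (metis * eq)
  qed
  moreover have "countable (range graph)"
    by (rule countable_subset[OF _ countable_Collect_finite]) (auto simp: graph_def)
  ultimately have "countable (UNIV :: ('a \<Rightarrow>\<^sub>0 'b) set)"
    using countable_image_inj_on by blast
  then show "\<exists>to_nat :: ('a \<Rightarrow>\<^sub>0 'b) \<Rightarrow> nat. inj to_nat"
    unfolding countable_def .
qed

lemma coeff_sum_monom:
  assumes "finite M"
  shows "coeff (\<Sum>m\<in>M. monom (g m) (h m)) k = (\<Sum>m\<in>{m \<in> M. h m = k}. g m)"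
  unfolding sum.inter_filter[OF assms] by (simp add: coeff_sum)

text \<open>The numbers are chosen one after the other, each of them outside the countable set of numbers
  algebraic over the ring generated by its predecessors. A relation is then read as a univariate
  polynomial in the number of largest index that it involves.\<close>

lemma algebraically_independent_family:
  fixes lo hi :: "nat \<Rightarrow> real"
  assumes "\<And>n. lo n < hi n"
  obtains v where "\<And>n. lo n < v n \<and> v n < hi n"
    "\<And>(A :: 'i set) s (M :: ('i \<Rightarrow> nat) set) c. \<lbrakk>finite A; inj_on s A; finite M;
        inj_on (\<lambda>m. restrict m A) M; c ` M \<subseteq> \<rat>; (\<Sum>m\<in>M. c m * (\<Prod>i\<in>A. v (s i) ^ m i)) = 0\<rbrakk>
      \<Longrightarrow> c ` M \<subseteq> {0}"
proof -
  define R :: "real set \<Rightarrow> real set" where "R S = countable_semiring_hull (\<rat> \<union> S)" for S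
  define Z where "Z S = {t. \<exists>p. p \<noteq> 0 \<and> range (coeff p) \<subseteq> R S \<and> poly p t = 0}" for S
  have "\<exists>v. \<forall>n. lo n < v n \<and> v n < hi n \<and> v n \<notin> Z (v ` {..<n})"
  \<comment> \<open>The rule chooses \<open>v n\<close> in terms of all earlier values; the first
    goal records that the condition depends on \<open>f\<close> only below \<open>n\<close>.\<close>
  proof (rule dependent_wellorder_choice)
    fix r and f g :: "nat \<Rightarrow> real" and n :: nat
    assume "\<And>y. y < n \<Longrightarrow> f y = g y"
    then have "f ` {..<n} = g ` {..<n}"
      by auto
    then show "(lo n < r \<and> r < hi n \<and> r \<notin> Z (f ` {..<n})) =
        (lo n < r \<and> r < hi n \<and> r \<notin> Z (g ` {..<n}))"
      by simp
  next
    fix n and f :: "nat \<Rightarrow> real"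
    have "countable (R (f ` {..<n}))"
      by (simp add: R_def countable_countable_semiring_hull)
    then have "countable (Z (f ` {..<n}))"
      unfolding Z_def by (rule countable_algebraic_over)
    moreover have "uncountable {lo n<..<hi n}"
      using assms[of n] by (simp add: uncountable_open_interval)
    ultimately have "\<not> {lo n<..<hi n} \<subseteq> Z (f ` {..<n})"
      using countable_subset by blast
    then show "\<exists>r. lo n < r \<and> r < hi n \<and> r \<notin> Z (f ` {..<n})"
      by auto
  qed
  then obtain v where v: "\<And>n. lo n < v n" "\<And>n. v n < hi n" "\<And>n. v n \<notin> Z (v ` {..<n})"
    by auto
  show ?thesis
  proof (rule that)
    show "lo n < v n \<and> v n < hi n" for n
      using v by simp
    fix A :: "'i set" and s M c
    assume "finite A" "inj_on s A" "finite M"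
      "inj_on (\<lambda>m. restrict m A) M" "c ` M \<subseteq> \<rat>" "(\<Sum>m\<in>M. c m * (\<Prod>i\<in>A. v (s i) ^ m i)) = 0"
    then show "c ` M \<subseteq> {0}"
    \<comment> \<open>Elements are added in order of increasing \<open>s\<close>, so the new element
      \<open>b\<close> carries the largest index and \<open>v (s b)\<close> was chosen last.\<close>
    proof (induction A arbitrary: M rule: finite_ranking_induct[where f = s])
      case empty
      \<comment> \<open>With no variables left all restrictions coincide, so \<open>M\<close> is a
        singleton and the relation reads \<open>c m = 0\<close>.\<close>
      have "c m = 0" if "m \<in> M" for m
      proof -
        have "m' = m" if "m' \<in> M" for m'
          using inj_onD[OF empty(3), of m' m] \<open>m \<in> M\<close> that by (simp add: restrict_def)
        then have "M = {m}"
          using that by blast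
        then show ?thesis
          using empty(5) by simp
      qed
      then show ?case
        by blast
    next
      case (insert b A)
      show ?case
      proof (cases "b \<in> A")
        case True
        then have "insert b A = A"
          by (rule insert_absorb)
        then show ?thesis
          using insert.prems by (intro insert.IH) simp_all
      next
        case False
        \<comment> \<open>The relation becomes a polynomial in \<open>v (s b)\<close>: terms are
          grouped by their exponent at \<open>b\<close>, and the factors \<open>g m\<close> involve
          only smaller indices.\<close>
        define g where "g m = c m * (\<Prod>i\<in>A. v (s i) ^ m i)" for m
        define p where "p = (\<Sum>m\<in>M. monom (g m) (m b))"
        have coeff: "coeff p k = (\<Sum>m\<in>{m \<in> M. m b = k}. g m)" for k
          unfolding p_def using \<open>finite M\<close> by (rule coeff_sum_monom)
        have "s ` A \<subseteq> {..<s b}"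
        proof (intro image_subsetI lessThan_iff[THEN iffD2])
          fix i assume "i \<in> A"
          then have "s i \<noteq> s b"
            using inj_onD[OF insert.prems(1), of i b] \<open>i \<in> A\<close> False by auto
          then show "s i < s b"
            using insert.hyps(2)[OF \<open>i \<in> A\<close>] by simp
        qed
        moreover define K where "K = R (v ` {..<s b})"
        moreover have "\<rat> \<union> v ` {..<s b} \<subseteq> K"
          using countable_semiring_hull_superset[of "\<rat> \<union> v ` {..<s b}"]
          by (simp add: K_def R_def countable_rat)
        ultimately have vK: "v (s i) \<in> K" if "i \<in> A" for i
          using that by blast
        have Q: "\<rat> \<subseteq> K"
          using \<open>\<rat> \<union> v ` {..<s b} \<subseteq> K\<close> by simp
        then have 01: "0 \<in> K" "1 \<in> K"
          by auto
        have plus: "x + y \<in> K" and times: "x * y \<in> K" if "x \<in> K" "y \<in> K" for x y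
          using that unfolding K_def R_def
          by (simp_all add: countable_semiring_hull_add countable_semiring_hull_mult)
        have pow: "v (s i) ^ k \<in> K" if "i \<in> A" for i k
          by (induction k) (simp_all add: 01 times vK that)
        have prod: "(\<Prod>i\<in>B. v (s i) ^ m i) \<in> K" if "B \<subseteq> A" for B m
          using finite_subset[OF that \<open>finite A\<close>] that
          by (induction B rule: finite_induct) (simp_all add: 01 times pow)
        have gK: "g m \<in> K" if "m \<in> M" for m
          unfolding g_def using that insert.prems(4) Q prod[of A m] by (intro times) auto
        have sum: "sum g N \<in> K" if "N \<subseteq> M" for N
          using finite_subset[OF that \<open>finite M\<close>] that
          by (induction N rule: finite_induct) (simp_all add: 01 plus gK)
        have "range (coeff p) \<subseteq> R (v ` {..<s b})"
          by (auto simp: coeff simp flip: K_def intro!: sum)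
        moreover have "poly p (v (s b)) = 0"
          using insert.prems(5) False \<open>finite A\<close>
          by (simp add: p_def poly_sum poly_monom g_def mult.assoc) (simp add: mult.commute)
        ultimately have "p = 0"
          using v(3)[of "s b"] unfolding Z_def by blast
        \<comment> \<open>Since \<open>p = 0\<close>, each of its coefficients is a relation over
          \<open>A\<close>. The exponent at \<open>b\<close> is fixed in it, which keeps the
          restrictions to \<open>A\<close> distinct.\<close>
        have "c ` {m \<in> M. m b = k} \<subseteq> {0}" for k
        proof (rule insert.IH)
          show "inj_on s A" "finite {m \<in> M. m b = k}" "c ` {m \<in> M. m b = k} \<subseteq> \<rat>"
            using insert.prems by auto
          show "inj_on (\<lambda>m. restrict m A) {m \<in> M. m b = k}"
          proof (rule inj_onI)
            fix m m' assume m: "m \<in> {m \<in> M. m b = k}" "m' \<in> {m \<in> M. m b = k}"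
              and eq: "restrict m A = restrict m' A"
            have "m x = m' x" if "x \<in> insert b A" for x
              using fun_cong[OF eq, of x] m that by auto
            then have "restrict m (insert b A) = restrict m' (insert b A)"
              by (rule restrict_ext)
            then show "m = m'"
              using inj_onD[OF insert.prems(3), of m m'] m by blast
          qed
          show "(\<Sum>m\<in>{m \<in> M. m b = k}. c m * (\<Prod>i\<in>A. v (s i) ^ m i)) = 0"
            using coeff[of k] \<open>p = 0\<close> by (simp add: g_def)
        qed
        then show ?thesis by blast
      qed
    qed
  qed
qed

text \<open>The previous result is carried over to an arbitrary countable index set, coded by
  \<open>to_nat_on\<close>, and to polynomials of type \<open>rat_mpoly\<close>, whose exponent
  functions are the \<open>lookup\<close> functions of their monomials.\<close>

lemma algebraically_independent_reals:
  fixes lo hi :: "'i \<Rightarrow> real"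
  assumes "countable I" and "\<And>i. i \<in> I \<Longrightarrow> lo i < hi i"
  obtains v where "\<And>i. i \<in> I \<Longrightarrow> lo i < v i \<and> v i < hi i"
    "\<And>r s P. \<lbrakk>s ` {1..r} \<subseteq> I; inj_on s {1..r}; P \<in> rat_mpolys r; P \<noteq> 0\<rbrakk>
      \<Longrightarrow> eval_rat_mpoly r P (\<lambda>i. v (s i)) \<noteq> 0"
proof -
  define index where "index = to_nat_on I"
  have inj: "inj_on index I"
    unfolding index_def using assms(1) by (rule inj_on_to_nat_on)
  \<comment> \<open>Numbers that code no element of \<open>I\<close> receive the interval from 0 to
    1, so that the lower bound is below the upper one at every number.\<close>
  define a where "a n = (if n \<in> index ` I then lo (inv_into I index n) else 0)" for n
  define b where "b n = (if n \<in> index ` I then hi (inv_into I index n) else 1)" for n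
  have ab: "a n < b n" for n
    unfolding a_def b_def using assms(2) by (simp add: inv_into_into)
  have ab_index: "a (index i) = lo i \<and> b (index i) = hi i" if "i \<in> I" for i
    unfolding a_def b_def using inj that by simp
  obtain w :: "nat \<Rightarrow> real" where w: "\<And>n. a n < w n \<and> w n < b n"
    "\<And>A s (M :: (nat \<Rightarrow> nat) set) c. \<lbrakk>finite A; inj_on s A; finite M;
        inj_on (\<lambda>m. restrict m A) M; c ` M \<subseteq> \<rat>; (\<Sum>m\<in>M. c m * (\<Prod>i\<in>A. w (s i) ^ m i)) = 0\<rbrakk>
      \<Longrightarrow> c ` M \<subseteq> {0}"
    by (rule algebraically_independent_family[where ?'i = nat and lo = a and hi = b, OF ab]) blast
  show ?thesis
  proof (rule that)
    show "lo i < w (index i) \<and> w (index i) < hi i" if "i \<in> I" for i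
      using w(1)[of "index i"] ab_index[OF that] by simp
    fix r s P
    assume s: "s ` {1..r} \<subseteq> I" "inj_on s {1..r}" and P: "P \<in> rat_mpolys r" "P \<noteq> 0"
    show "eval_rat_mpoly r P (\<lambda>i. w (index (s i))) \<noteq> 0"
    proof
      assume 0: "eval_rat_mpoly r P (\<lambda>i. w (index (s i))) = 0"
      let ?M = "Poly_Mapping.lookup ` Poly_Mapping.keys P"
      \<comment> \<open>\<open>Abs_poly_mapping\<close> recovers a monomial from its exponent
        function, so \<open>?c\<close> returns the coefficient of that monomial in
        \<open>P\<close>.\<close>
      let ?c = "\<lambda>m. of_rat (Poly_Mapping.lookup P (Abs_poly_mapping m)) :: real"
      have "?c ` ?M \<subseteq> {0}"
      proof (rule w(2))
        show "finite {1..r}" "finite ?M"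
          by simp_all
        show "inj_on (\<lambda>i. index (s i)) {1..r}"
          using comp_inj_on[OF s(2) inj_on_subset[OF inj s(1)]] by (simp add: comp_def)
        show "?c ` ?M \<subseteq> \<rat>"
          by auto
        \<comment> \<open>Exponents of variables outside \<open>{1..r}\<close> are 0, so a monomial
          of \<open>P\<close> is determined by the restriction.\<close>
        show "inj_on (\<lambda>m. restrict m {1..r}) ?M"
        proof (rule inj_onI, clarify)
          fix m m' assume m: "m \<in> Poly_Mapping.keys P" "m' \<in> Poly_Mapping.keys P"
            and eq: "restrict (Poly_Mapping.lookup m) {1..r} = restrict (Poly_Mapping.lookup m') {1..r}"
          show "Poly_Mapping.lookup m = Poly_Mapping.lookup m'"
          proof
            fix i
            show "Poly_Mapping.lookup m i = Poly_Mapping.lookup m' i"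
            proof (cases "i \<in> {1..r}")
              case True
              then show ?thesis using eq by (metis restrict_apply')
            next
              case False
              then have "i \<notin> Poly_Mapping.keys m" "i \<notin> Poly_Mapping.keys m'"
                using P(1) m unfolding rat_mpolys_def by blast+
              then show ?thesis by (simp add: in_keys_iff)
            qed
          qed
        qed
        have "inj_on Poly_Mapping.lookup (Poly_Mapping.keys P)"
          by (simp add: inj_on_def)
        then show "(\<Sum>m\<in>?M. ?c m * (\<Prod>i = 1..r. w (index (s i)) ^ m i)) = 0"
          using 0 by (simp add: sum.reindex eval_rat_mpoly_def)
      qed
      then have "Poly_Mapping.lookup P m = 0" for m
        by (auto simp: image_subset_iff in_keys_iff)
      with P(2) show False
        by (simp add: poly_mapping_eqI)
    qed
  qed
qed

section \<open>Nonvanishing of polynomials as an open condition\<close>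

text \<open>A Lipschitz condition for the maximum norm on a box, with \<delta> standing for any
  bound on the coordinate differences. The bound \<open>C\<close> is recorded along with
  \<open>L\<close> because the Lipschitz constant of a product depends on bounds of its
  factors.\<close>

definition box_lipschitz ::
    "'i set \<Rightarrow> real \<Rightarrow> real \<Rightarrow> real \<Rightarrow> (('i \<Rightarrow> real) \<Rightarrow> real) \<Rightarrow> bool" where
  "box_lipschitz I B C L f \<longleftrightarrow>
     (\<forall>t u \<delta>. 0 \<le> \<delta> \<and> (\<forall>i\<in>I. \<bar>t i\<bar> \<le> B \<and> \<bar>u i\<bar> \<le> B \<and> \<bar>t i - u i\<bar> \<le> \<delta>) \<longrightarrow>
        \<bar>f t\<bar> \<le> C \<and> \<bar>f u\<bar> \<le> C \<and> \<bar>f t - f u\<bar> \<le> L * \<delta>)"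

definition locally_lipschitz :: "'i set \<Rightarrow> (('i \<Rightarrow> real) \<Rightarrow> real) \<Rightarrow> bool" where
  "locally_lipschitz I f \<longleftrightarrow> (\<forall>B. \<exists>C L. box_lipschitz I B C L f)"

lemma box_lipschitzI:
  assumes "\<And>t u \<delta>. 0 \<le> \<delta> \<Longrightarrow> (\<forall>i\<in>I. \<bar>t i\<bar> \<le> B \<and> \<bar>u i\<bar> \<le> B \<and> \<bar>t i - u i\<bar> \<le> \<delta>) \<Longrightarrow>
      \<bar>f t\<bar> \<le> C \<and> \<bar>f u\<bar> \<le> C \<and> \<bar>f t - f u\<bar> \<le> L * \<delta>"
  shows "box_lipschitz I B C L f"
  using assms unfolding box_lipschitz_def by blast

lemma box_lipschitzD:
  assumes "box_lipschitz I B C L f" "0 \<le> \<delta>" "\<forall>i\<in>I. \<bar>t i\<bar> \<le> B \<and> \<bar>u i\<bar> \<le> B \<and> \<bar>t i - u i\<bar> \<le> \<delta>"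
  shows "\<bar>f t\<bar> \<le> C" "\<bar>f u\<bar> \<le> C" "\<bar>f t - f u\<bar> \<le> L * \<delta>"
  using assms unfolding box_lipschitz_def by blast+

lemma locally_lipschitz_const: "locally_lipschitz I (\<lambda>_. c)"
  unfolding locally_lipschitz_def
  by (intro allI exI[of _ "\<bar>c\<bar>"] exI[of _ 0] box_lipschitzI) simp

lemma locally_lipschitz_component: "i \<in> I \<Longrightarrow> locally_lipschitz I (\<lambda>t. t i)"
  unfolding locally_lipschitz_def
proof
  fix B :: real assume "i \<in> I"
  then have "box_lipschitz I B B 1 (\<lambda>t. t i)"
    by (intro box_lipschitzI) simp
  then show "\<exists>C L. box_lipschitz I B C L (\<lambda>t. t i)"
    by blast
qed

lemma locally_lipschitz_add:
  assumes "locally_lipschitz I f" "locally_lipschitz I g"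
  shows "locally_lipschitz I (\<lambda>t. f t + g t)"
  unfolding locally_lipschitz_def
proof
  fix B :: real
  obtain C L C' L' where f: "box_lipschitz I B C L f" and g: "box_lipschitz I B C' L' g"
    using assms unfolding locally_lipschitz_def by blast
  have "box_lipschitz I B (C + C') (L + L') (\<lambda>t. f t + g t)"
  proof (rule box_lipschitzI)
    fix t u \<delta> assume *: "0 \<le> \<delta>" "\<forall>i\<in>I. \<bar>t i\<bar> \<le> B \<and> \<bar>u i\<bar> \<le> B \<and> \<bar>t i - u i\<bar> \<le> \<delta>"
    show "\<bar>f t + g t\<bar> \<le> C + C' \<and> \<bar>f u + g u\<bar> \<le> C + C' \<and>
        \<bar>f t + g t - (f u + g u)\<bar> \<le> (L + L') * \<delta>"
      using box_lipschitzD[OF f *] box_lipschitzD[OF g *] unfolding distrib_right by linarith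
  qed
  then show "\<exists>C L. box_lipschitz I B C L (\<lambda>t. f t + g t)"
    by blast
qed

lemma locally_lipschitz_mult:
  assumes "locally_lipschitz I f" "locally_lipschitz I g"
  shows "locally_lipschitz I (\<lambda>t. f t * g t)"
  unfolding locally_lipschitz_def
proof
  fix B :: real
  obtain C L C' L' where f: "box_lipschitz I B C L f" and g: "box_lipschitz I B C' L' g"
    using assms unfolding locally_lipschitz_def by blast
  have "box_lipschitz I B (C * C') (C * L' + L * C') (\<lambda>t. f t * g t)"
  proof (rule box_lipschitzI)
    fix t u \<delta> assume *: "0 \<le> \<delta>" "\<forall>i\<in>I. \<bar>t i\<bar> \<le> B \<and> \<bar>u i\<bar> \<le> B \<and> \<bar>t i - u i\<bar> \<le> \<delta>"
    note bounds = box_lipschitzD[OF f *] box_lipschitzD[OF g *]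
    \<comment> \<open>The nonnegativity conditions of \<open>mult_mono\<close> follow from the
      bounds themselves, each of which dominates an absolute value.\<close>
    have "\<bar>f t * g t\<bar> \<le> C * C'" "\<bar>f u * g u\<bar> \<le> C * C'"
      "\<bar>f t * (g t - g u)\<bar> \<le> C * (L' * \<delta>)" "\<bar>(f t - f u) * g u\<bar> \<le> (L * \<delta>) * C'"
      unfolding abs_mult using bounds by (intro mult_mono; linarith)+
    moreover have "f t * g t - f u * g u = f t * (g t - g u) + (f t - f u) * g u"
      by (simp add: algebra_simps)
    moreover have "(C * L' + L * C') * \<delta> = C * (L' * \<delta>) + (L * \<delta>) * C'"
      by (simp add: algebra_simps)
    ultimately show "\<bar>f t * g t\<bar> \<le> C * C' \<and> \<bar>f u * g u\<bar> \<le> C * C' \<and>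
        \<bar>f t * g t - f u * g u\<bar> \<le> (C * L' + L * C') * \<delta>"
      by linarith
  qed
  then show "\<exists>C L. box_lipschitz I B C L (\<lambda>t. f t * g t)"
    by blast
qed

lemma locally_lipschitz_sum:
  "(\<And>a. a \<in> A \<Longrightarrow> locally_lipschitz I (f a)) \<Longrightarrow> locally_lipschitz I (\<lambda>t. \<Sum>a\<in>A. f a t)"
  by (induction A rule: infinite_finite_induct) (simp_all add: locally_lipschitz_const locally_lipschitz_add)

lemma locally_lipschitz_prod:
  "(\<And>a. a \<in> A \<Longrightarrow> locally_lipschitz I (f a)) \<Longrightarrow> locally_lipschitz I (\<lambda>t. \<Prod>a\<in>A. f a t)"
  by (induction A rule: infinite_finite_induct) (simp_all add: locally_lipschitz_const locally_lipschitz_mult)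

lemma locally_lipschitz_power:
  "locally_lipschitz I f \<Longrightarrow> locally_lipschitz I (\<lambda>t. f t ^ n)"
  by (induction n) (simp_all add: locally_lipschitz_const locally_lipschitz_mult)

lemma locally_lipschitz_eval_rat_mpoly: "locally_lipschitz {1..r} (eval_rat_mpoly r P)"
  unfolding eval_rat_mpoly_def
  by (intro locally_lipschitz_sum locally_lipschitz_mult locally_lipschitz_const locally_lipschitz_prod locally_lipschitz_power locally_lipschitz_component)

text \<open>Uniform continuity on a bounded box. Only \<open>t\<close> is confined to the box;
  \<open>u\<close> lies in the box enlarged by 1, because \<delta> is chosen at most 1.\<close>

lemma eval_rat_mpoly_close:
  assumes "0 < \<epsilon>"
  obtains \<delta> where "0 < \<delta>"
    "\<And>t u. \<lbrakk>\<And>i. i \<in> {1..r} \<Longrightarrow> \<bar>t i\<bar> \<le> B \<and> \<bar>t i - u i\<bar> \<le> \<delta>\<rbrakk>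
      \<Longrightarrow> \<bar>eval_rat_mpoly r P t - eval_rat_mpoly r P u\<bar> < \<epsilon>"
proof -
  obtain C L where L: "box_lipschitz {1..r} (B + 1) C L (eval_rat_mpoly r P)"
    using locally_lipschitz_eval_rat_mpoly[of r P] unfolding locally_lipschitz_def by blast
  \<comment> \<open>The denominator is positive whatever the sign of \<open>L\<close>, and its
    factor 2 leaves room for a strict inequality.\<close>
  define \<delta> where "\<delta> = min 1 (\<epsilon> / (2 * (\<bar>L\<bar> + 1)))"
  have "0 < \<delta>" "\<delta> \<le> 1"
    using assms by (auto simp: \<delta>_def)
  have "L * \<delta> \<le> (\<bar>L\<bar> + 1) * \<delta>"
    using \<open>0 < \<delta>\<close> by (intro mult_right_mono) auto
  also have "\<dots> \<le> (\<bar>L\<bar> + 1) * (\<epsilon> / (2 * (\<bar>L\<bar> + 1)))"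
    by (intro mult_left_mono) (auto simp: \<delta>_def)
  also have "\<dots> = \<epsilon> / 2"
    by (simp add: field_simps add_pos_nonneg)
  finally have "L * \<delta> < \<epsilon>"
    using assms by simp
  show ?thesis
  proof (rule that[OF \<open>0 < \<delta>\<close>])
    fix t u :: "nat \<Rightarrow> real"
    assume close: "\<bar>t i\<bar> \<le> B \<and> \<bar>t i - u i\<bar> \<le> \<delta>" if "i \<in> {1..r}" for i
    have "\<forall>i\<in>{1..r}. \<bar>t i\<bar> \<le> B + 1 \<and> \<bar>u i\<bar> \<le> B + 1 \<and> \<bar>t i - u i\<bar> \<le> \<delta>"
    proof
      fix i assume "i \<in> {1..r}"
      from close[OF this] show "\<bar>t i\<bar> \<le> B + 1 \<and> \<bar>u i\<bar> \<le> B + 1 \<and> \<bar>t i - u i\<bar> \<le> \<delta>"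
        using \<open>\<delta> \<le> 1\<close> by linarith
    qed
    from box_lipschitzD(3)[OF L _ this]
    show "\<bar>eval_rat_mpoly r P t - eval_rat_mpoly r P u\<bar> < \<epsilon>"
      using \<open>0 < \<delta>\<close> \<open>L * \<delta> < \<epsilon>\<close> by simp
  qed
qed

section \<open>The uniform metric and compact exhaustions\<close>

lemma capped_sup_dist_less:
  assumes "capped_sup_dist X d e < \<delta>" "\<delta> \<le> 1" "x \<in> topspace X" "y \<in> topspace X"
  shows "\<bar>d x y - e x y\<bar> < \<delta>"
proof -
  have "0 \<le> capped_sup_dist X d e"
    by (simp add: capped_sup_dist_def)
  then have "ennreal (capped_sup_dist X d e) < ennreal \<delta>"
    using assms(1) by (intro ennreal_lessI) linarith+
  moreover have "min 1 (sup_dist X d e) < top"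
    by (simp add: min_less_iff_disj)
  ultimately have "min 1 (sup_dist X d e) < ennreal \<delta>"
    by (simp add: capped_sup_dist_def)
  then have "sup_dist X d e < ennreal \<delta>"
    using assms(2) by (auto simp: min_def split: if_splits)
  then have "ennreal \<bar>d x y - e x y\<bar> < ennreal \<delta>"
    using sup_dist_upper[OF assms(3,4)] order_le_less_trans by blast
  then show ?thesis
    by (simp add: ennreal_less_iff)
qed

lemma capped_sup_dist_le:
  assumes "\<And>x y. x \<in> topspace X \<Longrightarrow> y \<in> topspace X \<Longrightarrow> \<bar>d x y - e x y\<bar> \<le> \<delta>" "0 \<le> \<delta>"
  shows "capped_sup_dist X d e \<le> \<delta>"
proof -
  have "sup_dist X d e \<le> ennreal \<delta>"
    unfolding sup_dist_def using assms by (intro SUP_least) (auto intro: ennreal_leI)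
  then show ?thesis
    unfolding capped_sup_dist_def using assms(2)
    by (intro enn2real_leI) (auto simp: min.coboundedI2)
qed

lemma Met_mtopology:
  assumes "d \<in> Met X"
  shows "Metric_space (topspace X) d" "Metric_space.mtopology (topspace X) d = X"
  using assms by (auto simp: Met_def)

lemma continuous_map_Met:
  assumes "d \<in> Met X" "continuous_map Y X f" "continuous_map Y X g"
  shows "continuous_map Y euclideanreal (\<lambda>z. d (f z) (g z))"
proof -
  interpret Metric_space "topspace X" d
    using Met_mtopology[OF assms(1)] by simp
  have "mtopology_of (metric (topspace X, d)) = X"
    using Met_mtopology[OF assms(1)] by (simp add: mtopology_of)
  then show ?thesis
    using continuous_map_mdist[of Y "metric (topspace X, d)" f g] assms by (simp add: mdist_metric)
qed

lemma sigma_compact_exhaustion: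
  assumes "sigma_compact_space X"
  obtains K :: "nat \<Rightarrow> 'a set" where "\<And>n. compactin X (K n)" "mono K" "\<Union> (range K) = topspace X"
proof -
  obtain \<K> where \<K>: "countable \<K>" "\<forall>K\<in>\<K>. compactin X K" "\<Union>\<K> = topspace X"
    using assms unfolding sigma_compact_space_def by (elim exE conjE)
  \<comment> \<open>The empty set is added so that the enumeration also works for an empty
    family.\<close>
  define f where "f = from_nat_into (insert {} \<K>)"
  have f: "range f = insert {} \<K>"
    unfolding f_def using \<K>(1) by (simp add: range_from_nat_into)
  have compact: "compactin X (f k)" for k
    using rangeI[of f k] \<K>(2) unfolding f by auto
  define L where "L n = (\<Union>k\<le>n. f k)" for n
  have "compactin X (L n)" for n
    unfolding L_def using compact by (intro compactin_Union) auto
  moreover have "mono L"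
    unfolding L_def by (intro monoI UN_mono) auto
  moreover have "\<Union> (range L) = \<Union> (range f)"
    unfolding L_def by blast
  then have "\<Union> (range L) = topspace X"
    using f \<K>(3) by simp
  ultimately show ?thesis
    by (rule that[of L])
qed

lemma eventually_inverse_Suc_le:
  assumes "0 < a"
  shows "\<forall>\<^sub>F n in sequentially. inverse (real (Suc n)) \<le> a"
  using order_tendstoD(2)[OF LIMSEQ_inverse_real_of_nat assms]
  by (rule eventually_mono) simp

lemma eventually_mem_exhaustion:
  assumes "mono K" "\<Union> (range K) = S" "x \<in> S"
  shows "\<forall>\<^sub>F n :: nat in sequentially. x \<in> K n"
proof -
  obtain n where "x \<in> K n"
    using assms by blast
  then show ?thesis
    using assms(1) by (auto simp: eventually_sequentially mono_def intro!: exI[of _ n])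
qed

section \<open>Compact sets of separated tuples\<close>

lemma compactin_superlevel_sets:
  assumes "compactin Y C" "\<And>h. h \<in> H \<Longrightarrow> continuous_map Y euclideanreal h"
  shows "compactin Y {z \<in> C. \<forall>h\<in>H. c \<le> h z}"
proof -
  have "closedin Y {z \<in> topspace Y. h z \<in> {c..}}" if "h \<in> H" for h
    using assms(2)[OF that] by (rule closedin_continuous_map_preimage) simp
  then have "closedin Y (\<Inter> (insert (topspace Y) ((\<lambda>h. {z \<in> topspace Y. h z \<in> {c..}}) ` H)))"
    by (intro closedin_Inter) auto
  then have "compactin Y (C \<inter> \<Inter> (insert (topspace Y) ((\<lambda>h. {z \<in> topspace Y. h z \<in> {c..}}) ` H)))"
    using assms(1) by (rule compact_Int_closedin[rotated])
  moreover have "C \<subseteq> topspace Y"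
    using assms(1) by (rule compactin_subset_topspace)
  then have "C \<inter> \<Inter> (insert (topspace Y) ((\<lambda>h. {z \<in> topspace Y. h z \<in> {c..}}) ` H)) =
      {z \<in> C. \<forall>h\<in>H. c \<le> h z}"
    by auto
  ultimately show ?thesis
    by simp
qed

text \<open>The last two inequalities say quantitatively that the unordered pairs with indices
  \<open>i\<close> and \<open>j\<close> differ: if they coincide, one of the two sums vanishes,
  depending on how the endpoints match. Weak inequalities keep the set closed.\<close>

definition separated_tuples ::
    "('a \<Rightarrow> 'a \<Rightarrow> real) \<Rightarrow> 'a set \<Rightarrow> real \<Rightarrow> nat \<Rightarrow> (nat \<Rightarrow> 'a \<times> 'a) set" where
  "separated_tuples d K c r = {z \<in> {1..r} \<rightarrow>\<^sub>E K \<times> K.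
     \<forall>i\<in>{1..r}. c \<le> d (fst (z i)) (snd (z i)) \<and>
       (\<forall>j\<in>{1..r} - {i}. c \<le> d (fst (z i)) (fst (z j)) + d (snd (z i)) (snd (z j)) \<and>
         c \<le> d (fst (z i)) (snd (z j)) + d (snd (z i)) (fst (z j)))}"

lemma compactin_separated_tuples:
  assumes "d \<in> Met X" "compactin X K"
  shows "compactin (product_topology (\<lambda>_. prod_topology X X) {1..r}) (separated_tuples d K c r)"
proof -
  let ?Y = "product_topology (\<lambda>_. prod_topology X X) {1..r}"
  define H where "H = (\<lambda>i z. d (fst (z i)) (snd (z i))) ` {1..r} \<union>
    (\<Union>i\<in>{1..r}. \<Union>j\<in>{1..r} - {i}.
       {\<lambda>z :: nat \<Rightarrow> 'a \<times> 'a. d (fst (z i)) (fst (z j)) + d (snd (z i)) (snd (z j)),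
        \<lambda>z. d (fst (z i)) (snd (z j)) + d (snd (z i)) (fst (z j))})"
  have proj: "continuous_map ?Y X (\<lambda>z. fst (z i))" "continuous_map ?Y X (\<lambda>z. snd (z i))"
    if "i \<in> {1..r}" for i
    using continuous_map_compose[OF continuous_map_product_projection[OF that] continuous_map_fst]
      continuous_map_compose[OF continuous_map_product_projection[OF that] continuous_map_snd]
    by (simp_all add: comp_def)
  have "continuous_map ?Y euclideanreal (\<lambda>z. d (fst (z i)) (snd (z i)))"
    "continuous_map ?Y euclideanreal (\<lambda>z. d (fst (z i)) (fst (z j)) + d (snd (z i)) (snd (z j)))"
    "continuous_map ?Y euclideanreal (\<lambda>z. d (fst (z i)) (snd (z j)) + d (snd (z i)) (fst (z j)))"
    if "i \<in> {1..r}" "j \<in> {1..r}" for i j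
    by (intro continuous_map_add continuous_map_Met[OF assms(1)] proj that)+
  then have cont: "continuous_map ?Y euclideanreal h" if "h \<in> H" for h
    using that unfolding H_def by blast
  have "compactin ?Y ({1..r} \<rightarrow>\<^sub>E K \<times> K)"
    using assms(2) by (simp add: compactin_PiE compactin_Times)
  then have "compactin ?Y {z \<in> {1..r} \<rightarrow>\<^sub>E K \<times> K. \<forall>h\<in>H. c \<le> h z}"
    using cont by (rule compactin_superlevel_sets)
  moreover have "{z \<in> {1..r} \<rightarrow>\<^sub>E K \<times> K. \<forall>h\<in>H. c \<le> h z} = separated_tuples d K c r"
    unfolding H_def separated_tuples_def by (simp add: ball_Un ball_conj_distrib del: One_nat_def)
  ultimately show ?thesis by simp
qed

text \<open>Finitely many positive numbers are involved, and all of them are at least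
  \<open>inverse (real (Suc n))\<close> for large \<open>n\<close>. So every tuple of distinct pairs
  is caught by one of countably many compact sets.\<close>

lemma eventually_separated_tuples:
  assumes "Metric_space S d" "mono K" "\<Union> (range K) = S"
    and xy: "\<And>i. i \<in> {1..r} \<Longrightarrow> x i \<in> S \<and> y i \<in> S \<and> x i \<noteq> y i"
    and inj: "inj_on (\<lambda>i. {x i, y i}) {1..r}"
  shows "\<forall>\<^sub>F n in sequentially.
    restrict (\<lambda>i. (x i, y i)) {1..r} \<in> separated_tuples d (K n) (inverse (real (Suc n))) r"
proof -
  interpret Metric_space S d
    by fact
  have pos: "0 < d a b + d a' b'" if "a \<in> S" "b \<in> S" "a' \<in> S" "b' \<in> S" "a \<noteq> b \<or> a' \<noteq> b'" for a b a' b'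
    using that by (metis add_nonneg_pos add_pos_nonneg mdist_pos_less nonneg)
  have "\<forall>\<^sub>F n in sequentially. x i \<in> K n \<and> y i \<in> K n \<and> inverse (real (Suc n)) \<le> d (x i) (y i) \<and>
      (\<forall>j\<in>{1..r} - {i}. inverse (real (Suc n)) \<le> d (x i) (x j) + d (y i) (y j) \<and>
         inverse (real (Suc n)) \<le> d (x i) (y j) + d (y i) (x j))" if i: "i \<in> {1..r}" for i
  proof (intro eventually_conj eventually_ball_finite ballI)
    show "\<forall>\<^sub>F n in sequentially. x i \<in> K n" "\<forall>\<^sub>F n in sequentially. y i \<in> K n"
      using xy[OF i] assms(2,3) by (simp_all add: eventually_mem_exhaustion)
    show "\<forall>\<^sub>F n in sequentially. inverse (real (Suc n)) \<le> d (x i) (y i)"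
      using xy[OF i] by (intro eventually_inverse_Suc_le) simp
    fix j assume j: "j \<in> {1..r} - {i}"
    then have "{x i, y i} \<noteq> {x j, y j}"
      using inj_onD[OF inj, of i j] i by auto
    then have "x i \<noteq> x j \<or> y i \<noteq> y j" "x i \<noteq> y j \<or> y i \<noteq> x j"
      by auto
    then show "\<forall>\<^sub>F n in sequentially. inverse (real (Suc n)) \<le> d (x i) (x j) + d (y i) (y j)"
      "\<forall>\<^sub>F n in sequentially. inverse (real (Suc n)) \<le> d (x i) (y j) + d (y i) (x j)"
      using xy[of i] xy[of j] i j by (intro eventually_inverse_Suc_le pos; simp)+
  qed simp
  then have "\<forall>\<^sub>F n in sequentially. \<forall>i\<in>{1..r}. x i \<in> K n \<and> y i \<in> K n \<and>
      inverse (real (Suc n)) \<le> d (x i) (y i) \<and>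
      (\<forall>j\<in>{1..r} - {i}. inverse (real (Suc n)) \<le> d (x i) (x j) + d (y i) (y j) \<and>
         inverse (real (Suc n)) \<le> d (x i) (y j) + d (y i) (x j))"
    by (intro eventually_ball_finite) auto
  then show ?thesis
    by (rule eventually_mono) (simp add: separated_tuples_def restrict_PiE_iff)
qed

text \<open>If two of the pairs had the same endpoints, one of the two sums in
  \<open>separated_tuples\<close> would be 0 and could not reach \<open>c\<close>.\<close>

lemma separated_tuples_distinct:
  assumes "Metric_space S d" "K \<subseteq> S" "0 < c" "z \<in> separated_tuples d K c r"
  shows "\<And>i. i \<in> {1..r} \<Longrightarrow> fst (z i) \<in> K \<and> snd (z i) \<in> K \<and> fst (z i) \<noteq> snd (z i)"
    and "inj_on (\<lambda>i. {fst (z i), snd (z i)}) {1..r}"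
proof -
  interpret Metric_space S d
    by fact
  show z: "fst (z i) \<in> K \<and> snd (z i) \<in> K \<and> fst (z i) \<noteq> snd (z i)" if "i \<in> {1..r}" for i
  proof -
    have "z i \<in> K \<times> K" "c \<le> d (fst (z i)) (snd (z i))"
      using assms(4) that unfolding separated_tuples_def by blast+
    then show ?thesis
      using assms(2,3) by (cases "z i") auto
  qed
  show "inj_on (\<lambda>i. {fst (z i), snd (z i)}) {1..r}"
  proof (rule inj_onI, rule ccontr)
    fix i j assume ij: "i \<in> {1..r}" "j \<in> {1..r}" "{fst (z i), snd (z i)} = {fst (z j), snd (z j)}" "i \<noteq> j"
    have "j \<in> {1..r} - {i}"
      using ij by simp
    then have c: "c \<le> d (fst (z i)) (fst (z j)) + d (snd (z i)) (snd (z j))"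
      "c \<le> d (fst (z i)) (snd (z j)) + d (snd (z i)) (fst (z j))"
      using assms(4) ij(1) unfolding separated_tuples_def by blast+
    have S: "fst (z i) \<in> S" "snd (z i) \<in> S"
      using z[OF ij(1)] assms(2) by auto
    have "fst (z i) = fst (z j) \<and> snd (z i) = snd (z j) \<or> fst (z i) = snd (z j) \<and> snd (z i) = fst (z j)"
      using ij(3) by (auto simp: doubleton_eq_iff)
    then show False
      using c S assms(3) by (elim disjE conjE) simp_all
  qed
qed

section \<open>Openness of the conditions and the G-delta property\<close>

lemma eval_rat_mpoly_cong:
  "(\<And>i. i \<in> {1..r} \<Longrightarrow> t i = u i) \<Longrightarrow> eval_rat_mpoly r P t = eval_rat_mpoly r P u"
  unfolding eval_rat_mpoly_def by (intro sum.cong arg_cong2[where f = "(*)"] prod.cong refl) simp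

definition nonvanishing_on ::
    "'a topology \<Rightarrow> (nat \<Rightarrow> 'a \<times> 'a) set \<Rightarrow> nat \<Rightarrow> rat_mpoly \<Rightarrow> ('a \<Rightarrow> 'a \<Rightarrow> real) set" where
  "nonvanishing_on X T r P =
     {e \<in> Met X. \<forall>z\<in>T. eval_rat_mpoly r P (\<lambda>i. e (fst (z i)) (snd (z i))) \<noteq> 0}"

text \<open>A polynomial in the distances of \<open>e\<close> is continuous on the compact set
  \<open>T\<close>, so its modulus has a positive lower bound \<epsilon> there. Since
  \<open>e\<close> is bounded on \<open>K\<close>, a small uniform change of \<open>e\<close> moves
  all these values by less than \<epsilon>.\<close>

lemma openin_nonvanishing_on:
  assumes K: "compactin X K"
    and T: "compactin (product_topology (\<lambda>_. prod_topology X X) {1..r}) T" "T \<subseteq> {1..r} \<rightarrow>\<^sub>E K \<times> K"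
  shows "openin (Met_topology X) (nonvanishing_on X T r P)"
proof -
  interpret M: Metric_space "Met X" "capped_sup_dist X"
    by (rule Metric_space_Met)
  let ?Y = "product_topology (\<lambda>_. prod_topology X X) {1..r}"
  let ?F = "\<lambda>e z. eval_rat_mpoly r P (\<lambda>i. e (fst (z i)) (snd (z i)))"
  show ?thesis
    unfolding Met_topology_def M.openin_mtopology
  proof (intro conjI allI impI)
    show "nonvanishing_on X T r P \<subseteq> Met X"
      by (auto simp: nonvanishing_on_def)
    fix e assume "e \<in> nonvanishing_on X T r P"
    then have e: "e \<in> Met X" "\<And>z. z \<in> T \<Longrightarrow> ?F e z \<noteq> 0"
      by (auto simp: nonvanishing_on_def)
    have proj: "continuous_map ?Y X (\<lambda>z. fst (z i))" "continuous_map ?Y X (\<lambda>z. snd (z i))"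
      if "i \<in> {1..r}" for i
      using continuous_map_compose[OF continuous_map_product_projection[OF that] continuous_map_fst]
        continuous_map_compose[OF continuous_map_product_projection[OF that] continuous_map_snd]
      by (simp_all add: comp_def)
    have "continuous_map ?Y euclideanreal (?F e)"
      unfolding eval_rat_mpoly_def
      by (intro continuous_map_sum continuous_map_real_mult continuous_map_prod continuous_map_real_pow
          continuous_map_Met[OF e(1)] proj) auto
    then have "compactin euclideanreal (?F e ` T)"
      by (rule image_compactin[OF T(1)])
    then have "open (- (?F e ` T))"
      by (simp add: compact_imp_closed open_Compl)
    moreover have "0 \<in> - (?F e ` T)"
      using e(2) by force
    ultimately obtain \<epsilon> where "0 < \<epsilon>" and sub: "ball 0 \<epsilon> \<subseteq> - (?F e ` T)"
      by (rule openE)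
    have \<epsilon>: "\<epsilon> \<le> \<bar>?F e z\<bar>" if "z \<in> T" for z
    proof -
      have "?F e z \<notin> ball 0 \<epsilon>"
        using sub that by blast
      then show ?thesis
        by simp
    qed
    interpret X: Metric_space "topspace X" e
      using Met_mtopology(1)[OF e(1)] .
    have "X.mbounded K"
      using K Met_mtopology(2)[OF e(1)] by (intro X.compactin_imp_mbounded) simp
    then obtain B where B: "\<And>x y. x \<in> K \<Longrightarrow> y \<in> K \<Longrightarrow> e x y \<le> B"
      unfolding X.mbounded_alt by blast
    obtain \<delta> where \<delta>: "0 < \<delta>" "\<And>t u. \<lbrakk>\<And>i. i \<in> {1..r} \<Longrightarrow> \<bar>t i\<bar> \<le> B \<and> \<bar>t i - u i\<bar> \<le> \<delta>\<rbrakk>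
      \<Longrightarrow> \<bar>eval_rat_mpoly r P t - eval_rat_mpoly r P u\<bar> < \<epsilon>"
      by (rule eval_rat_mpoly_close[OF \<open>0 < \<epsilon>\<close>, of r B P]) blast
    show "\<exists>\<rho>>0. M.mball e \<rho> \<subseteq> nonvanishing_on X T r P"
    proof (intro exI[of _ "min 1 \<delta>"] conjI subsetI)
      show "0 < min 1 \<delta>"
        using \<delta>(1) by simp
      fix e' assume "e' \<in> M.mball e (min 1 \<delta>)"
      then have e': "e' \<in> Met X" "capped_sup_dist X e e' < min 1 \<delta>"
        by auto
      have "?F e' z \<noteq> 0" if "z \<in> T" for z
      proof -
        have "\<bar>e (fst (z i)) (snd (z i))\<bar> \<le> B \<and>
            \<bar>e (fst (z i)) (snd (z i)) - e' (fst (z i)) (snd (z i))\<bar> \<le> \<delta>" if "i \<in> {1..r}" for i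
        proof -
          have "fst (z i) \<in> K" "snd (z i) \<in> K"
            using T(2) \<open>z \<in> T\<close> that by (auto simp: PiE_iff subset_iff mem_Times_iff)
          moreover have "K \<subseteq> topspace X"
            using K by (rule compactin_subset_topspace)
          ultimately show ?thesis
            using B[of "fst (z i)" "snd (z i)"]
              capped_sup_dist_less[OF e'(2), of "fst (z i)" "snd (z i)"] by (auto simp: subset_iff)
        qed
        then have "\<bar>?F e z - ?F e' z\<bar> < \<epsilon>"
          by (rule \<delta>(2))
        then show ?thesis
          using \<epsilon>[OF that] by auto
      qed
      then show "e' \<in> nonvanishing_on X T r P"
        using e'(1) by (simp add: nonvanishing_on_def)
    qed
  qed
qed

text \<open>Algebraic independence is the conjunction of the conditions
  \<open>nonvanishing_on\<close> over all \<open>n\<close>, all \<open>r\<close> and all nonzero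
  \<open>P\<close>, hence of countably many open conditions.\<close>

lemma gdelta_in_Met_alg_indep:
  assumes "sigma_compact_space X"
  shows "gdelta_in (Met_topology X) (Met_alg_indep X)"
proof -
  obtain K :: "nat \<Rightarrow> 'a set" where K: "\<And>n. compactin X (K n)" "mono K" "\<Union> (range K) = topspace X"
    using sigma_compact_exhaustion[OF assms] by metis
  show ?thesis
  proof (cases "Met X = {}")
    case True
    then have "Met_alg_indep X = {}"
      by (simp add: Met_alg_indep_def)
    then show ?thesis
      by simp
  next
    case False
    then obtain d where d: "d \<in> Met X"
      by blast
    \<comment> \<open>One fixed metric \<open>d\<close> measures the separation of tuples for every
      \<open>e\<close>; the sets of tuples must not vary with \<open>e\<close>.\<close>
    define T where "T n r = separated_tuples d (K n) (inverse (real (Suc n))) r" for n r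
    define W where "W = insert (Met X) ((\<lambda>(n, r, P). nonvanishing_on X (T n r) r P) `
      (UNIV \<times> (SIGMA r:{1..}. rat_mpolys r - {0})))"
    have K_sub: "K n \<subseteq> topspace X" for n
      using K(1) by (rule compactin_subset_topspace)
    have "gdelta_in (Met_topology X) (\<Inter>W)"
    proof (rule gdelta_in_Inter)
      show "countable W"
        unfolding W_def by (intro countable_insert countable_image countable_SIGMA) auto
      show "W \<noteq> {}"
        by (simp add: W_def)
      have "openin (Met_topology X) (nonvanishing_on X (T n r) r P)" for n r P
        unfolding T_def
        by (intro openin_nonvanishing_on[OF K(1)] compactin_separated_tuples[OF d K(1)])
          (auto simp: separated_tuples_def)
      moreover have "openin (Met_topology X) (Met X)"
        using openin_topspace[of "Met_topology X"] by simp
      ultimately show "gdelta_in (Met_topology X) U" if "U \<in> W" for U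
        using that by (auto simp: W_def intro!: open_imp_gdelta_in)
    qed
    also have "\<Inter>W = Met_alg_indep X"
    proof (intro equalityI subsetI)
      fix e assume e: "e \<in> \<Inter>W"
      have "e \<in> Met X"
        using e by (simp add: W_def)
      moreover have "eval_rat_mpoly r P (\<lambda>i. e (x i) (y i)) \<noteq> 0"
        if "r \<ge> 1" "\<forall>i\<in>{1..r}. x i \<in> topspace X \<and> y i \<in> topspace X \<and> x i \<noteq> y i"
          "inj_on (\<lambda>i. {x i, y i}) {1..r}" "P \<in> rat_mpolys r" "P \<noteq> 0" for r x y P
      proof -
        have "\<forall>\<^sub>F n in sequentially. restrict (\<lambda>i. (x i, y i)) {1..r} \<in> T n r"
          unfolding T_def using that(2,3) Met_mtopology(1)[OF d] K(2,3)
          by (intro eventually_separated_tuples) auto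
        then obtain n where n: "restrict (\<lambda>i. (x i, y i)) {1..r} \<in> T n r"
          using eventually_happens'[OF sequentially_bot] by blast
        have "e \<in> nonvanishing_on X (T n r) r P"
          using e that(1,4,5) by (force simp: W_def)
        then have "eval_rat_mpoly r P (\<lambda>i. e (fst (restrict (\<lambda>i. (x i, y i)) {1..r} i))
            (snd (restrict (\<lambda>i. (x i, y i)) {1..r} i))) \<noteq> 0"
          unfolding nonvanishing_on_def using n by blast
        also have "eval_rat_mpoly r P (\<lambda>i. e (fst (restrict (\<lambda>i. (x i, y i)) {1..r} i))
            (snd (restrict (\<lambda>i. (x i, y i)) {1..r} i))) = eval_rat_mpoly r P (\<lambda>i. e (x i) (y i))"
          by (rule eval_rat_mpoly_cong) simp
        finally show ?thesis .
      qed
      ultimately show "e \<in> Met_alg_indep X"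
        unfolding Met_alg_indep_def alg_indep_distances_def by simp
    next
      fix e assume "e \<in> Met_alg_indep X"
      then have e: "e \<in> Met X" "alg_indep_distances (topspace X) e"
        by (auto simp: Met_alg_indep_def)
      have "e \<in> nonvanishing_on X (T n r) r P" if "1 \<le> r" "P \<in> rat_mpolys r" "P \<noteq> 0" for n r P
      proof -
        have "eval_rat_mpoly r P (\<lambda>i. e (fst (z i)) (snd (z i))) \<noteq> 0" if "z \<in> T n r" for z
        proof -
          have "0 < inverse (real (Suc n))"
            by simp
          from separated_tuples_distinct[OF Met_mtopology(1)[OF d] K_sub this that[unfolded T_def]]
          show ?thesis
            using e(2)[unfolded alg_indep_distances_def, rule_format, of r "\<lambda>i. fst (z i)" "\<lambda>i. snd (z i)" P]
              \<open>1 \<le> r\<close> \<open>P \<in> rat_mpolys r\<close> \<open>P \<noteq> 0\<close> K_sub[of n] by blast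
        qed
        then show ?thesis
          using e(1) by (simp add: nonvanishing_on_def)
      qed
      then show "e \<in> \<Inter>W"
        using e(1) by (auto simp: W_def)
    qed
    finally show ?thesis .
  qed
qed

section \<open>Clopen partitions and pseudometrics on their classes\<close>

text \<open>Refine the cover by a ball and the complement of \<open>x\<close> to one in which no
  point lies in two members. The member containing \<open>x\<close> must lie in the ball, and its
  complement is the union of the other members, hence open.\<close>

lemma zero_dimensional_clopen_neighbourhood:
  assumes "strongly_zero_dimensional X" "d \<in> Met X" "x \<in> topspace X" "0 < \<epsilon>"
  obtains W where "openin X W" "closedin X W" "x \<in> W" "\<And>y. y \<in> W \<Longrightarrow> d x y < \<epsilon>"
proof -
  interpret Metric_space "topspace X" d
    using Met_mtopology(1)[OF assms(2)] .
  have X: "mtopology = X"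
    using Met_mtopology(2)[OF assms(2)] .
  have "openin X (mball x \<epsilon>)" "closedin X {x}"
    using openin_mball[of x \<epsilon>] closedin_Hausdorff_sing_eq[OF Hausdorff_space_mtopology, of x] assms(3)
    by (simp_all add: X)
  then have "finite_open_cover X {mball x \<epsilon>, topspace X - {x}}"
    using assms(3,4) unfolding finite_open_cover_def by auto
  moreover have "covering_dim_le X 0"
    using assms(1,3) by (auto simp: strongly_zero_dimensional_def has_covering_dim_def)
  ultimately obtain \<V> where \<V>: "finite_open_cover X \<V>"
    "\<forall>V\<in>\<V>. \<exists>U\<in>{mball x \<epsilon>, topspace X - {x}}. V \<subseteq> U"
    "\<forall>x\<in>topspace X. int (card {V \<in> \<V>. x \<in> V}) \<le> 0 + 1"
    unfolding covering_dim_le_def by meson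
  have disjoint: "V = V'" if "V \<in> \<V>" "V' \<in> \<V>" "y \<in> V" "y \<in> V'" for V V' y
  proof -
    have "y \<in> topspace X"
      using \<V>(1) that by (auto simp: finite_open_cover_def)
    then have "card {V \<in> \<V>. y \<in> V} \<le> Suc 0"
      using \<V>(3) by force
    moreover have "finite {V \<in> \<V>. y \<in> V}"
      using \<V>(1) by (simp add: finite_open_cover_def)
    ultimately show ?thesis
      using that by (auto simp: card_le_Suc0_iff_eq)
  qed
  obtain W where W: "W \<in> \<V>" "x \<in> W"
    using \<V>(1) assms(3) by (auto simp: finite_open_cover_def)
  then have "W \<subseteq> mball x \<epsilon>"
    using \<V>(2) by blast
  have op: "openin X V" if "V \<in> \<V>" for V
    using \<V>(1) that by (simp add: finite_open_cover_def)
  have "topspace X - W = \<Union> (\<V> - {W})"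
    using \<V>(1) W disjoint unfolding finite_open_cover_def by blast
  moreover have "openin X (\<Union> (\<V> - {W}))"
    using op by blast
  ultimately have "closedin X W"
    using openin_subset[OF op[OF W(1)]] by (simp add: closedin_def)
  moreover have "d x y < \<epsilon>" if "y \<in> W" for y
    using that \<open>W \<subseteq> mball x \<epsilon>\<close> by auto
  ultimately show ?thesis
    using that[of W] op[OF W(1)] W(2) by blast
qed

text \<open>Small clopen sets cover the space, and by \<sigma>-compactness countably many suffice.
  Labelling each point by the least index of a member containing it makes the cover
  disjoint.\<close>

lemma zero_dimensional_clopen_partition:
  assumes "strongly_zero_dimensional X" "sigma_compact_space X" "d \<in> Met X" "0 < \<epsilon>"
  shows "\<exists>q :: 'a \<Rightarrow> nat. (\<forall>k. openin X {x \<in> topspace X. q x = k}) \<and>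
    (\<forall>x\<in>topspace X. \<forall>y\<in>topspace X. q x = q y \<longrightarrow> d x y < \<epsilon>)"
proof -
  interpret Metric_space "topspace X" d
    using Met_mtopology(1)[OF assms(3)] .
  define small where "small W \<longleftrightarrow> openin X W \<and> closedin X W \<and> (\<forall>y\<in>W. \<forall>z\<in>W. d y z < \<epsilon>)" for W
  have "\<exists>W. small W \<and> x \<in> W" if x: "x \<in> topspace X" for x
  proof -
    \<comment> \<open>Distances below \<epsilon> / 2 to the centre give mutual distances below
      \<epsilon>.\<close>
    have "0 < \<epsilon> / 2"
      using assms(4) by simp
    obtain W where W: "openin X W" "closedin X W" "x \<in> W" "\<And>y. y \<in> W \<Longrightarrow> d x y < \<epsilon> / 2"
      by (rule zero_dimensional_clopen_neighbourhood[OF assms(1,3) x \<open>0 < \<epsilon> / 2\<close>]) blast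
    have "d y z < \<epsilon>" if "y \<in> W" "z \<in> W" for y z
    proof -
      have "y \<in> topspace X" "z \<in> topspace X"
        using that openin_subset[OF W(1)] by auto
      then show ?thesis
        using triangle'[of y x z] W(4)[OF that(1)] W(4)[OF that(2)] x by (simp add: commute)
    qed
    then have "small W"
      using W(1,2) by (simp add: small_def)
    then show ?thesis
      using W(3) by blast
  qed
  then have cover: "topspace X \<subseteq> \<Union> (Collect small)"
    by blast
  obtain K :: "nat \<Rightarrow> 'a set" where K: "\<And>n. compactin X (K n)" "mono K" "\<Union> (range K) = topspace X"
    by (rule sigma_compact_exhaustion[OF assms(2)]) blast
  have "\<exists>\<F>. finite \<F> \<and> \<F> \<subseteq> Collect small \<and> K n \<subseteq> \<Union>\<F>" for n
  proof (rule compactinD[OF K(1)])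
    show "openin X U" if "U \<in> Collect small" for U
      using that by (simp add: small_def)
    show "K n \<subseteq> \<Union> (Collect small)"
      using compactin_subset_topspace[OF K(1)] cover by blast
  qed
  then have "\<forall>n. \<exists>\<F>. finite \<F> \<and> \<F> \<subseteq> Collect small \<and> K n \<subseteq> \<Union>\<F>"
    by blast
  from choice[OF this] obtain \<F> where \<F>: "\<forall>n. finite (\<F> n) \<and> \<F> n \<subseteq> Collect small \<and> K n \<subseteq> \<Union> (\<F> n)" ..
  define \<W> where "\<W> = insert {} (\<Union> (range \<F>))"
  define w where "w = from_nat_into \<W>"
  have "countable (\<F> n)" for n
    using \<F> by (simp add: countable_finite)
  then have "countable \<W>"
    unfolding \<W>_def by simp
  then have w: "range w = \<W>"
    unfolding w_def by (intro range_from_nat_into) (simp_all add: \<W>_def)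
  have small: "small (w k)" for k
  proof -
    have "w k \<in> \<W>"
      using w by blast
    then have "w k = {} \<or> w k \<in> Collect small"
      unfolding \<W>_def using \<F> by blast
    moreover have "small {}"
      by (simp add: small_def)
    ultimately show ?thesis
      by auto
  qed
  define q where "q x = (LEAST k. x \<in> w k)" for x
  have q: "x \<in> w (q x)" if "x \<in> topspace X" for x
  proof -
    have "x \<in> \<Union> (range K)"
      using that K(3) by simp
    then obtain n where "x \<in> K n"
      by blast
    then obtain W where "W \<in> \<F> n" "x \<in> W"
      using \<F> by blast
    then have "W \<in> range w"
      unfolding w by (auto simp: \<W>_def)
    then obtain k where "x \<in> w k"
      using \<open>x \<in> W\<close> by blast
    then show ?thesis
      unfolding q_def by (rule LeastI)
  qed
  have "openin X {x \<in> topspace X. q x = k}" for k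
  proof -
    have "{x \<in> topspace X. q x = k} = w k - (\<Union>j<k. w j)"
    proof (intro equalityI subsetI)
      fix x assume "x \<in> {x \<in> topspace X. q x = k}"
      then show "x \<in> w k - (\<Union>j<k. w j)"
        using q[of x] not_less_Least[of _ "\<lambda>k. x \<in> w k", folded q_def] by auto
    next
      fix x assume x: "x \<in> w k - (\<Union>j<k. w j)"
      have "k \<le> j" if "x \<in> w j" for j
        using x that by (cases "j < k") auto
      then have "q x = k"
        unfolding q_def using x by (intro Least_equality) auto
      then show "x \<in> {x \<in> topspace X. q x = k}"
        using x openin_subset[of X "w k"] small[of k] by (auto simp: small_def)
    qed
    moreover have "closedin X (\<Union>j<k. w j)"
      using small by (intro closedin_Union) (auto simp: small_def)
    ultimately show ?thesis
      using small[of k] by (simp add: small_def openin_diff)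
  qed
  moreover have "d x y < \<epsilon>" if "x \<in> topspace X" "y \<in> topspace X" "q x = q y" for x y
    using q[OF that(1)] q[OF that(2)] small[of "q x"] that(3) by (simp add: small_def)
  ultimately show ?thesis
    by (intro exI[of _ q] conjI allI ballI impI)
qed

text \<open>The label at stage \<open>n\<close> is the list of the labels in the partitions 0 to
  \<open>n\<close>, so that refinement is built in.\<close>

lemma zero_dimensional_refining_partitions:
  assumes "strongly_zero_dimensional X" "sigma_compact_space X" "d \<in> Met X" "\<And>n. 0 < \<delta> n"
  obtains p :: "nat \<Rightarrow> 'a \<Rightarrow> nat list" where "\<And>n c. openin X {x \<in> topspace X. p n x = c}"
    "\<And>m n x y. m \<le> n \<Longrightarrow> p n x = p n y \<Longrightarrow> p m x = p m y"
    "\<And>n x y. \<lbrakk>x \<in> topspace X; y \<in> topspace X; p n x = p n y\<rbrakk> \<Longrightarrow> d x y < \<delta> n"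
proof -
  have "\<forall>n. \<exists>q :: 'a \<Rightarrow> nat. (\<forall>k. openin X {x \<in> topspace X. q x = k}) \<and>
    (\<forall>x\<in>topspace X. \<forall>y\<in>topspace X. q x = q y \<longrightarrow> d x y < \<delta> n)"
    using zero_dimensional_clopen_partition[OF assms(1-3)] assms(4) by blast
  from choice[OF this] obtain q :: "nat \<Rightarrow> 'a \<Rightarrow> nat" where
    q: "\<forall>n. (\<forall>k. openin X {x \<in> topspace X. q n x = k}) \<and>
      (\<forall>x\<in>topspace X. \<forall>y\<in>topspace X. q n x = q n y \<longrightarrow> d x y < \<delta> n)" ..
  define p where "p n x = map (\<lambda>k. q k x) [0..<Suc n]" for n x
  have p_eq: "p n x = p n y \<longleftrightarrow> (\<forall>k\<le>n. q k x = q k y)" for n x y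
    by (auto simp: p_def simp del: upt_Suc)
  show ?thesis
  proof (rule that[of p])
    show "openin X {x \<in> topspace X. p n x = c}" for n c
    proof (subst openin_subopen, intro ballI)
      fix x assume x: "x \<in> {x \<in> topspace X. p n x = c}"
      let ?T = "(\<Inter>k\<in>{..n}. {y \<in> topspace X. q k y = q k x}) \<inter> topspace X"
      have "openin X ?T"
        using q by (intro openin_INT) auto
      moreover have "x \<in> ?T"
        using x by simp
      moreover have "?T \<subseteq> {x \<in> topspace X. p n x = c}"
      proof
        fix y assume "y \<in> ?T"
        then have "y \<in> topspace X" "p n y = p n x"
          unfolding p_eq by auto
        then show "y \<in> {x \<in> topspace X. p n x = c}"
          using x by simp
      qed
      ultimately show "\<exists>T. openin X T \<and> x \<in> T \<and> T \<subseteq> {x \<in> topspace X. p n x = c}"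
        by blast
    qed
    show "p m x = p m y" if "m \<le> n" "p n x = p n y" for m n x y
      using that unfolding p_eq by simp
    show "d x y < \<delta> n" if "x \<in> topspace X" "y \<in> topspace X" "p n x = p n y" for n x y
      using q that unfolding p_eq by simp
  qed
qed

text \<open>The triangle inequality makes such a function descend to the classes of \<open>p\<close>, see
  \<open>class_pseudometric_cong\<close>.\<close>

definition class_pseudometric :: "'a set \<Rightarrow> ('a \<Rightarrow> 'b) \<Rightarrow> ('a \<Rightarrow> 'a \<Rightarrow> real) \<Rightarrow> bool" where
  "class_pseudometric S p e \<longleftrightarrow>
     (\<forall>x\<in>S. \<forall>y\<in>S. 0 \<le> e x y \<and> e x y = e y x \<and> (p x = p y \<longrightarrow> e x y = 0) \<and>
        (\<forall>z\<in>S. e x z \<le> e x y + e y z))"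

lemma class_pseudometricD:
  assumes "class_pseudometric S p e" "x \<in> S" "y \<in> S"
  shows "0 \<le> e x y" "e x y = e y x" "p x = p y \<Longrightarrow> e x y = 0"
    "z \<in> S \<Longrightarrow> e x z \<le> e x y + e y z"
  using assms unfolding class_pseudometric_def by blast+

lemma class_pseudometric_cong:
  assumes e: "class_pseudometric S p e" and S: "x \<in> S" "y \<in> S" "x' \<in> S" "y' \<in> S"
    and p: "p x = p x'" "p y = p y'"
  shows "e x y = e x' y'"
proof -
  have "e x x' = 0" "e x' x = 0" "e y y' = 0" "e y' y = 0"
    using class_pseudometricD(3)[OF e] S p by simp_all
  moreover note class_pseudometricD(4)[OF e S(1,3,2)] class_pseudometricD(4)[OF e S(3,1,2)]
    class_pseudometricD(4)[OF e S(3,2,4)] class_pseudometricD(4)[OF e S(3,4,2)]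
  ultimately show ?thesis by linarith
qed

lemma class_pseudometric_refine:
  assumes "class_pseudometric S p e" "\<And>x y. q x = q y \<Longrightarrow> p x = p y"
  shows "class_pseudometric S q e"
  unfolding class_pseudometric_def
proof (intro ballI conjI impI)
  fix x y assume "x \<in> S" "y \<in> S"
  note D = class_pseudometricD[OF assms(1) this]
  show "0 \<le> e x y" "e x y = e y x"
    by (fact D)+
  show "e x y = 0" if "q x = q y"
    using D(3) assms(2)[OF that] .
  show "e x z \<le> e x y + e y z" if "z \<in> S" for z
    using D(4)[OF that] .
qed

text \<open>Adding any symmetric function with values in \<open>[t, 2 * t]\<close> off the diagonal classes preserves the
  triangle inequality, so the new values can be prescribed independently of each other.\<close>

lemma class_pseudometric_perturb:
  fixes p :: "'a \<Rightarrow> 'b::countable"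
  assumes e: "class_pseudometric S p e" and "0 < t"
  obtains e' where "class_pseudometric S p e'"
    "\<And>x y. \<lbrakk>x \<in> S; y \<in> S; p x \<noteq> p y\<rbrakk> \<Longrightarrow> e x y + t < e' x y \<and> e' x y < e x y + 2 * t"
    "\<And>r x y P. \<lbrakk>\<And>i. i \<in> {1..r} \<Longrightarrow> x i \<in> S \<and> y i \<in> S \<and> p (x i) \<noteq> p (y i);
        inj_on (\<lambda>i. {p (x i), p (y i)}) {1..r}; P \<in> rat_mpolys r; P \<noteq> 0\<rbrakk>
      \<Longrightarrow> eval_rat_mpoly r P (\<lambda>i. e' (x i) (y i)) \<noteq> 0"
proof -
  \<comment> \<open>The value of \<open>e\<close> as a function of the unordered pair of labels. It
    does not depend on the points chosen, by symmetry and \<open>class_pseudometric_cong\<close>; on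
    sets that are no such pair it is arbitrary.\<close>
  define base where "base c = (SOME a. \<exists>x\<in>S. \<exists>y\<in>S. c = {p x, p y} \<and> a = e x y)" for c
  have base: "base {p x, p y} = e x y" if "x \<in> S" "y \<in> S" for x y
  proof -
    have "\<exists>a. \<exists>x'\<in>S. \<exists>y'\<in>S. {p x, p y} = {p x', p y'} \<and> a = e x' y'"
      using that by blast
    then have "\<exists>x'\<in>S. \<exists>y'\<in>S. {p x, p y} = {p x', p y'} \<and> base {p x, p y} = e x' y'"
      unfolding base_def by (rule someI_ex)
    then obtain x' y' where *: "x' \<in> S" "y' \<in> S" "{p x, p y} = {p x', p y'}" "base {p x, p y} = e x' y'"
      by blast
    then have "p x = p x' \<and> p y = p y' \<or> p x = p y' \<and> p y = p x'"
      by (auto simp: doubleton_eq_iff)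
    then have "e x y = e x' y'"
      using class_pseudometric_cong[OF e that *(1,2)] class_pseudometric_cong[OF e that *(2,1)]
        class_pseudometricD(2)[OF e *(1,2)] by auto
    then show ?thesis
      using *(4) by simp
  qed
  have countable: "countable {c :: 'b set. finite c}"
    by (rule countable_Collect_finite)
  have less: "base c + t < base c + 2 * t" if "c \<in> {c. finite c}" for c
    using assms(2) by simp
  obtain v where v: "\<And>c. c \<in> {c. finite c} \<Longrightarrow> base c + t < v c \<and> v c < base c + 2 * t"
    "\<And>r s P. \<lbrakk>s ` {1..r} \<subseteq> {c. finite c}; inj_on s {1..r}; P \<in> rat_mpolys r; P \<noteq> 0\<rbrakk>
      \<Longrightarrow> eval_rat_mpoly r P (\<lambda>i. v (s i)) \<noteq> 0"
    by (rule algebraically_independent_reals[OF countable less]) blast+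
  define e' where "e' x y = (if p x = p y then 0 else v {p x, p y})" for x y
  have bounds: "e x y + t < e' x y \<and> e' x y < e x y + 2 * t" if "x \<in> S" "y \<in> S" "p x \<noteq> p y" for x y
    using v(1)[of "{p x, p y}"] base[OF that(1,2)] that(3) by (simp add: e'_def)
  have sym: "e' x y = e' y x" for x y
    by (simp add: e'_def insert_commute)
  have nonneg: "0 \<le> e' x y" if "x \<in> S" "y \<in> S" for x y
    using bounds[OF that] class_pseudometricD(1)[OF e that] assms(2)
    by (cases "p x = p y") (auto simp: e'_def)
  have "e' x z \<le> e' x y + e' y z" if S: "x \<in> S" "y \<in> S" "z \<in> S" for x y z
  proof -
    consider "p x = p z" | "p x = p y" | "p y = p z" | "p x \<noteq> p z" "p x \<noteq> p y" "p y \<noteq> p z"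
      by blast
    then show ?thesis
    proof cases
      case 1
      then show ?thesis
        using nonneg[OF S(1,2)] nonneg[OF S(2,3)] by (simp add: e'_def)
    next
      \<comment> \<open>The left side is below \<open>e x z + 2 * t\<close>, while each of the two
        summands on the right gains at least \<open>t\<close>.\<close>
      case 4
      then show ?thesis
        using bounds[of x z] bounds[of x y] bounds[of y z] class_pseudometricD(4)[OF e S(1,2,3)] S
        by linarith
    qed (simp_all add: e'_def)
  qed
  then have pseudometric: "class_pseudometric S p e'"
    using nonneg sym unfolding class_pseudometric_def by (simp add: e'_def)
  have nonzero: "eval_rat_mpoly r P (\<lambda>i. e' (x i) (y i)) \<noteq> 0"
    if "\<And>i. i \<in> {1..r} \<Longrightarrow> x i \<in> S \<and> y i \<in> S \<and> p (x i) \<noteq> p (y i)"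
      "inj_on (\<lambda>i. {p (x i), p (y i)}) {1..r}" "P \<in> rat_mpolys r" "P \<noteq> 0" for r x y P
  proof -
    have "eval_rat_mpoly r P (\<lambda>i. e' (x i) (y i)) = eval_rat_mpoly r P (\<lambda>i. v {p (x i), p (y i)})"
      using that(1) by (intro eval_rat_mpoly_cong) (simp add: e'_def)
    then show ?thesis
      using v(2)[of "\<lambda>i. {p (x i), p (y i)}" r P] that(2-4) by auto
  qed
  show ?thesis
    by (rule that[of e', OF pseudometric bounds nonzero])
qed

text \<open>Only finitely many tuples have their entries in \<open>V\<close>, so the nonzero values
  of each \<open>P\<close> on them have a least modulus, and uniform continuity yields a tolerance.
  The least tolerance serves all of \<open>J\<close>.\<close>

lemma nonvanishing_persists:
  assumes "finite V" "finite J"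
  shows "\<exists>\<tau>>0. \<forall>(r, P)\<in>J. \<forall>t u. (\<forall>i\<in>{1..r}. t i \<in> V \<and> \<bar>t i - u i\<bar> \<le> \<tau>) \<longrightarrow>
    eval_rat_mpoly r P t \<noteq> 0 \<longrightarrow> eval_rat_mpoly r P u \<noteq> 0"
  using assms(2)
proof (induction J rule: finite_induct)
  case empty
  show ?case by (intro exI[of _ 1]) simp
next
  case (insert rP J)
  obtain r P where rP: "rP = (r, P)"
    by (cases rP)
  obtain \<tau> where \<tau>: "0 < \<tau>" "\<forall>(r, P)\<in>J. \<forall>t u. (\<forall>i\<in>{1..r}. t i \<in> V \<and> \<bar>t i - u i\<bar> \<le> \<tau>) \<longrightarrow>
    eval_rat_mpoly r P t \<noteq> 0 \<longrightarrow> eval_rat_mpoly r P u \<noteq> 0"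
    using insert.IH by blast
  define A where "A = (\<lambda>t. \<bar>eval_rat_mpoly r P t\<bar>) ` ({1..r} \<rightarrow>\<^sub>E V) - {0}"
  \<comment> \<open>Adding 1 keeps the minimum meaningful when \<open>A\<close> is empty.\<close>
  define \<epsilon> where "\<epsilon> = Min (insert 1 A)"
  have "finite A"
    unfolding A_def using assms(1) by (intro finite_Diff finite_imageI finite_PiE) auto
  then have "0 < \<epsilon>"
    unfolding \<epsilon>_def by (auto simp: A_def)
  obtain B where B: "\<And>a. a \<in> V \<Longrightarrow> \<bar>a\<bar> \<le> B"
    using finite_imp_bounded[OF assms(1)] unfolding bounded_iff real_norm_def by blast
  obtain \<delta> where \<delta>: "0 < \<delta>" "\<And>t u. \<lbrakk>\<And>i. i \<in> {1..r} \<Longrightarrow> \<bar>t i\<bar> \<le> B \<and> \<bar>t i - u i\<bar> \<le> \<delta>\<rbrakk>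
      \<Longrightarrow> \<bar>eval_rat_mpoly r P t - eval_rat_mpoly r P u\<bar> < \<epsilon>"
    by (rule eval_rat_mpoly_close[OF \<open>0 < \<epsilon>\<close>, of r B P]) blast
  have new: "eval_rat_mpoly r P u \<noteq> 0"
    if tu: "\<forall>i\<in>{1..r}. t i \<in> V \<and> \<bar>t i - u i\<bar> \<le> \<delta>" and nz: "eval_rat_mpoly r P t \<noteq> 0" for t u
  proof -
    have "\<bar>eval_rat_mpoly r P t - eval_rat_mpoly r P u\<bar> < \<epsilon>"
      using tu B by (intro \<delta>(2)) blast
    moreover have "eval_rat_mpoly r P (restrict t {1..r}) = eval_rat_mpoly r P t"
      by (rule eval_rat_mpoly_cong) simp
    then have "\<bar>eval_rat_mpoly r P t\<bar> \<in> A"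
      unfolding A_def using tu nz by (intro DiffI image_eqI[of _ _ "restrict t {1..r}"]) auto
    then have "\<epsilon> \<le> \<bar>eval_rat_mpoly r P t\<bar>"
      unfolding \<epsilon>_def using \<open>finite A\<close> by (intro Min_le) auto
    ultimately show ?thesis by auto
  qed
  have "\<forall>(r, P)\<in>insert rP J. \<forall>t u. (\<forall>i\<in>{1..r}. t i \<in> V \<and> \<bar>t i - u i\<bar> \<le> min \<tau> \<delta>) \<longrightarrow>
    eval_rat_mpoly r P t \<noteq> 0 \<longrightarrow> eval_rat_mpoly r P u \<noteq> 0"
    unfolding rP using \<tau>(2) new by fastforce
  moreover have "0 < min \<tau> \<delta>"
    using \<tau>(1) \<delta>(1) by simp
  ultimately show ?case
    by blast
qed

text \<open>The classes of \<open>p\<close> form an open cover, so the compact set \<open>K\<close>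
  meets finitely many of them, and \<open>e\<close> depends only on the classes.\<close>

lemma finite_class_pseudometric_values:
  assumes e: "class_pseudometric (topspace X) p e" and K: "compactin X K"
    and p: "\<And>c. openin X {x \<in> topspace X. p x = c}"
  shows "finite ((\<lambda>(x, y). e x y) ` (K \<times> K))"
proof -
  have sub: "K \<subseteq> topspace X"
    using K by (rule compactin_subset_topspace)
  have "\<exists>\<F>. finite \<F> \<and> \<F> \<subseteq> range (\<lambda>c. {x \<in> topspace X. p x = c}) \<and> K \<subseteq> \<Union>\<F>"
    using sub p by (intro compactinD[OF K]) auto
  then obtain \<F> where \<F>: "finite \<F>" "\<F> \<subseteq> range (\<lambda>c. {x \<in> topspace X. p x = c})" "K \<subseteq> \<Union>\<F>"
    by blast
  obtain C where C: "finite C" "\<F> = (\<lambda>c. {x \<in> topspace X. p x = c}) ` C"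
    using finite_subset_image[OF \<F>(1,2)] by blast
  have "p ` K \<subseteq> C"
    using \<F>(3) unfolding C(2) by auto
  then have "finite (p ` K)"
    using C(1) finite_subset by blast
  then obtain F where F: "F \<subseteq> K" "finite F" "p ` K = p ` F"
    using finite_subset_image[OF \<open>finite (p ` K)\<close> subset_refl] by blast
  have "e x y \<in> (\<lambda>(x, y). e x y) ` (F \<times> F)" if "x \<in> K" "y \<in> K" for x y
  proof -
    have "p x \<in> p ` F" "p y \<in> p ` F"
      using that unfolding F(3)[symmetric] by simp_all
    then obtain x' y' where *: "x' \<in> F" "y' \<in> F" "p x = p x'" "p y = p y'"
      by (elim imageE)
    then have "e x y = e x' y'"
      using that sub F(1) by (intro class_pseudometric_cong[OF e]) auto
    then show ?thesis
      using * by (intro image_eqI[of _ _ "(x', y')"]) auto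
  qed
  then have "(\<lambda>(x, y). e x y) ` (K \<times> K) \<subseteq> (\<lambda>(x, y). e x y) ` (F \<times> F)"
    by auto
  then show ?thesis
    using F(2) finite_subset by blast
qed

section \<open>Density\<close>

text \<open>The second condition asks for open neighbourhoods instead of balls of \<open>d\<close>,
  so that partition classes can be used directly.\<close>

lemma mtopology_eqI:
  assumes d: "d \<in> Met X" and e: "Metric_space (topspace X) e"
    and finer: "\<And>x r. x \<in> topspace X \<Longrightarrow> 0 < r \<Longrightarrow> \<exists>s>0. \<forall>y\<in>topspace X. e x y < s \<longrightarrow> d x y < r"
    and coarser: "\<And>x r. x \<in> topspace X \<Longrightarrow> 0 < r \<Longrightarrow>
      \<exists>U. openin X U \<and> x \<in> U \<and> (\<forall>y\<in>U. e x y < r)"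
  shows "Metric_space.mtopology (topspace X) e = X"
proof -
  interpret D: Metric_space "topspace X" d
    using Met_mtopology(1)[OF d] .
  interpret E: Metric_space "topspace X" e
    by fact
  have "openin E.mtopology V \<longleftrightarrow> openin X V" for V
  proof
    assume V: "openin E.mtopology V"
    show "openin X V"
    proof (subst openin_subopen, intro ballI)
      fix x assume "x \<in> V"
      with V obtain r where r: "0 < r" "E.mball x r \<subseteq> V"
        unfolding E.openin_mtopology by blast
      have x: "x \<in> topspace X"
        using V \<open>x \<in> V\<close> unfolding E.openin_mtopology by blast
      obtain U where U: "openin X U" "x \<in> U" "\<forall>y\<in>U. e x y < r"
        using coarser[OF x r(1)] by blast
      then have "U \<subseteq> V"
        using openin_subset[OF U(1)] x r(2) by (auto simp: subset_iff)
      then show "\<exists>T. openin X T \<and> x \<in> T \<and> T \<subseteq> V"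
        using U by blast
    qed
  next
    assume "openin X V"
    then have V: "openin D.mtopology V"
      using Met_mtopology(2)[OF d] by simp
    show "openin E.mtopology V"
      unfolding E.openin_mtopology
    proof (intro conjI allI impI)
      show "V \<subseteq> topspace X"
        using V unfolding D.openin_mtopology by blast
      fix x assume "x \<in> V"
      with V obtain r where r: "0 < r" "D.mball x r \<subseteq> V"
        unfolding D.openin_mtopology by blast
      have x: "x \<in> topspace X"
        using V \<open>x \<in> V\<close> unfolding D.openin_mtopology by blast
      obtain s where "0 < s" "\<forall>y\<in>topspace X. e x y < s \<longrightarrow> d x y < r"
        using finer[OF x r(1)] by blast
      then have "E.mball x s \<subseteq> D.mball x r"
        by auto
      then show "\<exists>r>0. E.mball x r \<subseteq> V"
        using r(2) \<open>0 < s\<close> by blast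
    qed
  qed
  then show ?thesis
    by (simp add: topology_eq)
qed

text \<open>Later perturbations of total size at most \<open>\<tau>\<close> do not destroy the relations \<open>P \<noteq> 0\<close> with
  \<open>(r, P) \<in> J\<close> between points of \<open>K\<close> that \<open>p\<close> separates.\<close>

definition robustly_independent ::
    "'a set \<Rightarrow> ('a \<Rightarrow> 'b) \<Rightarrow> (nat \<times> rat_mpoly) set \<Rightarrow> ('a \<Rightarrow> 'a \<Rightarrow> real) \<Rightarrow> real \<Rightarrow> bool" where
  "robustly_independent K p J e \<tau> \<longleftrightarrow>
     (\<forall>f r P x y. (\<forall>a\<in>K. \<forall>b\<in>K. \<bar>e a b - f a b\<bar> \<le> \<tau>) \<longrightarrow> (r, P) \<in> J \<longrightarrow>
        (\<forall>i\<in>{1..r}. x i \<in> K \<and> y i \<in> K \<and> p (x i) \<noteq> p (y i)) \<longrightarrow>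
        inj_on (\<lambda>i. {p (x i), p (y i)}) {1..r} \<longrightarrow>
        eval_rat_mpoly r P (\<lambda>i. f (x i) (y i)) \<noteq> 0)"

text \<open>One stage of the construction: \<open>class_pseudometric_perturb\<close> with
  \<open>t / 8\<close> supplies the increments, and finiteness of the values on \<open>K\<close>
  turns the finitely many relations in \<open>J\<close> into a tolerance for later changes.\<close>

lemma robust_perturbation:
  fixes p :: "'a \<Rightarrow> 'b::countable"
  assumes e: "class_pseudometric (topspace X) p e" and t: "0 < t" and K: "compactin X K"
    and p: "\<And>c. openin X {x \<in> topspace X. p x = c}"
    and J: "finite J" "\<forall>(r, P)\<in>J. P \<in> rat_mpolys r \<and> P \<noteq> 0"
  shows "\<exists>e' t'. class_pseudometric (topspace X) p e' \<and> 0 < t' \<and> t' \<le> t / 2 \<and>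
    (\<forall>x\<in>topspace X. \<forall>y\<in>topspace X. e x y \<le> e' x y \<and> e' x y \<le> e x y + t / 4 \<and>
      (p x \<noteq> p y \<longrightarrow> e x y + t / 8 \<le> e' x y)) \<and>
    robustly_independent K p J e' t'"
proof -
  have "0 < t / 8"
    using t by simp
  obtain e' where e': "class_pseudometric (topspace X) p e'"
    and bounds: "\<And>x y. \<lbrakk>x \<in> topspace X; y \<in> topspace X; p x \<noteq> p y\<rbrakk>
      \<Longrightarrow> e x y + t / 8 < e' x y \<and> e' x y < e x y + 2 * (t / 8)"
    and nonzero: "\<And>r x y P. \<lbrakk>\<And>i. i \<in> {1..r} \<Longrightarrow> x i \<in> topspace X \<and> y i \<in> topspace X \<and> p (x i) \<noteq> p (y i);
        inj_on (\<lambda>i. {p (x i), p (y i)}) {1..r}; P \<in> rat_mpolys r; P \<noteq> 0\<rbrakk>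
      \<Longrightarrow> eval_rat_mpoly r P (\<lambda>i. e' (x i) (y i)) \<noteq> 0"
    by (rule class_pseudometric_perturb[OF e \<open>0 < t / 8\<close>]) blast
  have "finite ((\<lambda>(x, y). e' x y) ` (K \<times> K))"
    by (rule finite_class_pseudometric_values[OF e' K p])
  from nonvanishing_persists[OF this J(1)] obtain \<tau> where "0 < \<tau>" and
    \<tau>: "\<forall>(r, P)\<in>J. \<forall>s u. (\<forall>i\<in>{1..r}. s i \<in> (\<lambda>(x, y). e' x y) ` (K \<times> K) \<and> \<bar>s i - u i\<bar> \<le> \<tau>) \<longrightarrow>
      eval_rat_mpoly r P s \<noteq> 0 \<longrightarrow> eval_rat_mpoly r P u \<noteq> 0"
    by blast
  \<comment> \<open>The bound \<tau> protects the relations in \<open>J\<close>, and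
    \<open>t / 2\<close> makes the later increments summable.\<close>
  define t' where "t' = min \<tau> (t / 2)"
  have "robustly_independent K p J e' t'"
    unfolding robustly_independent_def
  proof (intro allI impI)
    fix f r P x y
    assume f: "\<forall>a\<in>K. \<forall>b\<in>K. \<bar>e' a b - f a b\<bar> \<le> t'" and "(r, P) \<in> J"
      and xy: "\<forall>i\<in>{1..r}. x i \<in> K \<and> y i \<in> K \<and> p (x i) \<noteq> p (y i)"
      and inj: "inj_on (\<lambda>i. {p (x i), p (y i)}) {1..r}"
    have "eval_rat_mpoly r P (\<lambda>i. e' (x i) (y i)) \<noteq> 0"
      using xy compactin_subset_topspace[OF K] bspec[OF J(2) \<open>(r, P) \<in> J\<close>] inj
      by (intro nonzero) auto
    moreover have "\<forall>i\<in>{1..r}. e' (x i) (y i) \<in> (\<lambda>(x, y). e' x y) ` (K \<times> K) \<and>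
        \<bar>e' (x i) (y i) - f (x i) (y i)\<bar> \<le> \<tau>"
    proof (intro ballI conjI)
      fix i assume "i \<in> {1..r}"
      have K: "x i \<in> K" "y i \<in> K"
        using xy \<open>i \<in> {1..r}\<close> by auto
      then show "e' (x i) (y i) \<in> (\<lambda>(x, y). e' x y) ` (K \<times> K)"
        by (intro image_eqI[of _ _ "(x i, y i)"]) auto
      show "\<bar>e' (x i) (y i) - f (x i) (y i)\<bar> \<le> \<tau>"
        using f K unfolding t'_def by fastforce
    qed
    ultimately show "eval_rat_mpoly r P (\<lambda>i. f (x i) (y i)) \<noteq> 0"
      using spec[OF spec[OF bspec[OF \<tau> \<open>(r, P) \<in> J\<close>, unfolded prod.case], of "\<lambda>i. e' (x i) (y i)"],
          of "\<lambda>i. f (x i) (y i)"] by blast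
  qed
  moreover have "0 < t'" "t' \<le> t / 2"
    using t \<open>0 < \<tau>\<close> by (auto simp: t'_def)
  moreover have "e x y \<le> e' x y \<and> e' x y \<le> e x y + t / 4 \<and> (p x \<noteq> p y \<longrightarrow> e x y + t / 8 \<le> e' x y)"
    if "x \<in> topspace X" "y \<in> topspace X" for x y
  proof (cases "p x = p y")
    case True
    then show ?thesis
      using class_pseudometricD(3)[OF e that] class_pseudometricD(3)[OF e' that] t by simp
  next
    case False
    then show ?thesis
      using bounds[OF that False] t by simp
  qed
  ultimately show ?thesis
    using e' by (intro exI[of _ e'] exI[of _ t'] conjI ballI) blast+
qed

text \<open>The sequence \<open>e n x y\<close> increases while \<open>e n x y + t n / 2\<close>
  decreases, because both the increment and \<open>t (Suc n) / 2\<close> are at most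
  \<open>t n / 4\<close>. So the limit exceeds \<open>e n\<close> by at most
  \<open>t n / 2\<close>.\<close>

lemma converging_pseudometrics:
  fixes e :: "nat \<Rightarrow> 'a \<Rightarrow> 'a \<Rightarrow> real" and t :: "nat \<Rightarrow> real"
  assumes t: "\<And>n. 0 < t n" "\<And>n. t (Suc n) \<le> t n / 2"
    and e: "\<And>n x y. x \<in> S \<Longrightarrow> y \<in> S \<Longrightarrow> e n x y \<le> e (Suc n) x y \<and> e (Suc n) x y \<le> e n x y + t n / 4"
  obtains E where "\<And>x y. x \<notin> S \<or> y \<notin> S \<Longrightarrow> E x y = 0"
    "\<And>x y. x \<in> S \<Longrightarrow> y \<in> S \<Longrightarrow> (\<lambda>n. e n x y) \<longlonglongrightarrow> E x y"
    "\<And>n x y. x \<in> S \<Longrightarrow> y \<in> S \<Longrightarrow> e n x y \<le> E x y \<and> E x y \<le> e n x y + t n / 2"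
proof -
  define E where "E x y = (if x \<in> S \<and> y \<in> S then lim (\<lambda>n. e n x y) else 0)" for x y
  have inc: "incseq (\<lambda>n. e n x y)" if "x \<in> S" "y \<in> S" for x y
    using e[OF that] by (simp add: incseq_Suc_iff)
  \<comment> \<open>Subtracting \<open>t (n + k) / 2\<close> is what carries the induction; the term
    is dropped afterwards.\<close>
  have upper: "e (n + k) x y \<le> e n x y + t n / 2 - t (n + k) / 2" if "x \<in> S" "y \<in> S" for n k x y
  proof (induction k)
    case (Suc k)
    then show ?case
      using conjunct2[OF e[OF that, of "n + k"]] t(2)[of "n + k"] unfolding add_Suc_right by linarith
  qed simp
  have bound: "e m x y \<le> e n x y + t n / 2" if "x \<in> S" "y \<in> S" for m n x y
  proof (cases "n \<le> m")
    case True
    then obtain k where "m = n + k"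
      using le_Suc_ex by blast
    then show ?thesis
      using upper[OF that, of n k] t(1)[of "n + k"] by simp
  next
    case False
    then have "e m x y \<le> e n x y"
      using inc[OF that] by (simp add: incseq_def)
    then show ?thesis
      using t(1)[of n] by simp
  qed
  have lim: "(\<lambda>n. e n x y) \<longlonglongrightarrow> E x y" if S: "x \<in> S" "y \<in> S" for x y
  proof -
    obtain L where "(\<lambda>n. e n x y) \<longlonglongrightarrow> L"
      using incseq_convergent[OF inc[OF S], of "e 0 x y + t 0 / 2"] bound[OF S] by blast
    then show ?thesis
      using S by (simp add: E_def limI)
  qed
  show ?thesis
  proof (rule that[of E])
    show "E x y = 0" if "x \<notin> S \<or> y \<notin> S" for x y
      using that by (auto simp: E_def)
    show "(\<lambda>n. e n x y) \<longlonglongrightarrow> E x y" if "x \<in> S" "y \<in> S" for x y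
      by (rule lim[OF that])
    show "e n x y \<le> E x y \<and> E x y \<le> e n x y + t n / 2" if "x \<in> S" "y \<in> S" for n x y
      using incseq_le[OF inc[OF that] lim[OF that]] LIMSEQ_le_const2[OF lim[OF that]] bound[OF that]
      by blast
  qed
qed

lemma dense_Met_alg_indep:
  assumes "strongly_zero_dimensional X" "sigma_compact_space X" "d \<in> Met X" "0 < \<epsilon>"
  shows "\<exists>e\<in>Met_alg_indep X. \<forall>x\<in>topspace X. \<forall>y\<in>topspace X. \<bar>d x y - e x y\<bar> \<le> \<epsilon>"
proof -
  let ?S = "topspace X"
  interpret D: Metric_space ?S d
    using Met_mtopology(1)[OF assms(3)] .
  obtain K :: "nat \<Rightarrow> 'a set" where K: "\<And>n. compactin X (K n)" "mono K" "\<Union> (range K) = ?S"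
    by (rule sigma_compact_exhaustion[OF assms(2)]) blast
  \<comment> \<open>At stage 0 a point and its representative are less than \<epsilon> / 4 apart,
    which costs at most \<epsilon> / 2 for a pair. The other half of \<epsilon> is left for the
    perturbations.\<close>
  define \<delta> where "\<delta> n = \<epsilon> / 4 * inverse (real (Suc n))" for n
  have \<delta>_pos: "0 < \<delta> n" for n
    using assms(4) by (simp add: \<delta>_def)
  obtain p :: "nat \<Rightarrow> 'a \<Rightarrow> nat list" where p_open: "\<And>n c. openin X {x \<in> ?S. p n x = c}"
    and p_refine: "\<And>m n x y. m \<le> n \<Longrightarrow> p n x = p n y \<Longrightarrow> p m x = p m y"
    and p_small: "\<And>n x y. \<lbrakk>x \<in> ?S; y \<in> ?S; p n x = p n y\<rbrakk> \<Longrightarrow> d x y < \<delta> n"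
    by (rule zero_dimensional_refining_partitions[where \<delta> = \<delta>, OF assms(1-3) \<delta>_pos]) blast

  \<comment> \<open>The initial pseudometric on representatives\<close>
  define rep where "rep x = (SOME y. y \<in> ?S \<and> p 0 y = p 0 x)" for x
  have rep: "rep x \<in> ?S" "p 0 (rep x) = p 0 x" if "x \<in> ?S" for x
    using someI[of "\<lambda>y. y \<in> ?S \<and> p 0 y = p 0 x" x] that by (simp_all add: rep_def)
  define e0 where "e0 x y = d (rep x) (rep y)" for x y
  have e0: "class_pseudometric ?S (p 0) e0"
  proof -
    have "rep x = rep y" if "p 0 x = p 0 y" for x y
      using that by (simp add: rep_def)
    then have "e0 x y = 0" if "x \<in> ?S" "p 0 x = p 0 y" for x y
      using that rep(1)[OF that(1)] by (metis D.mdist_zero e0_def)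
    moreover have "e0 x z \<le> e0 x y + e0 y z" if "x \<in> ?S" "y \<in> ?S" "z \<in> ?S" for x y z
      unfolding e0_def by (intro D.triangle rep(1) that)
    ultimately show ?thesis
      unfolding class_pseudometric_def
    proof (intro ballI conjI impI)
      show "0 \<le> e0 x y" "e0 x y = e0 y x" for x y
        unfolding e0_def by (rule D.nonneg, rule D.commute)
    qed
  qed
  have e0_close: "\<bar>d x y - e0 x y\<bar> \<le> \<epsilon> / 2" if S: "x \<in> ?S" "y \<in> ?S" for x y
  proof -
    have "d x (rep x) < \<epsilon> / 4" "d y (rep y) < \<epsilon> / 4"
      using p_small[of x "rep x" 0] p_small[of y "rep y" 0] rep S by (simp_all add: \<delta>_def)
    then show ?thesis
      using D.triangle[OF S(1) rep(1)[OF S(1)] S(2)] D.triangle[OF rep(1)[OF S(1)] rep(1)[OF S(2)] S(2)]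
        D.triangle[OF rep(1)[OF S(1)] S(1) rep(1)[OF S(2)]] D.triangle[OF S rep(1)[OF S(2)]]
        D.commute[of x "rep x"] D.commute[of y "rep y"]
      unfolding e0_def by linarith
  qed

  \<comment> \<open>Recursive choice of pseudometrics and tolerances\<close>
  define J :: "nat \<Rightarrow> (nat \<times> rat_mpoly) set"
    where "J n = {(r, P) \<in> from_nat ` {..n}. P \<in> rat_mpolys r \<and> P \<noteq> 0}" for n
  \<comment> \<open>Every admissible pair \<open>(r, P)\<close> belongs to \<open>J n\<close> once
    \<open>n\<close> reaches its code, so each relation is eventually protected.\<close>
  have J: "finite (J n)" "\<forall>(r, P)\<in>J n. P \<in> rat_mpolys r \<and> P \<noteq> 0" for n
    by (auto simp: J_def intro: finite_subset[of _ "from_nat ` {..n}"])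
  \<comment> \<open>A state \<open>F n\<close> is a pseudometric together with the tolerance left
    for later changes. The clause for \<open>n = 0\<close> fixes the start; the second bracket
    relates consecutive states.\<close>
  have "\<exists>F. \<forall>n. (class_pseudometric ?S (p n) (fst (F n)) \<and> 0 < snd (F n) \<and> (n = 0 \<longrightarrow> F n = (e0, \<epsilon>))) \<and>
      (snd (F (Suc n)) \<le> snd (F n) / 2 \<and>
       (\<forall>x\<in>?S. \<forall>y\<in>?S. fst (F n) x y \<le> fst (F (Suc n)) x y \<and>
          fst (F (Suc n)) x y \<le> fst (F n) x y + snd (F n) / 4 \<and>
          (p (Suc n) x \<noteq> p (Suc n) y \<longrightarrow> fst (F n) x y + snd (F n) / 8 \<le> fst (F (Suc n)) x y)) \<and>
       robustly_independent (K n) (p (Suc n)) (J n) (fst (F (Suc n))) (snd (F (Suc n))))"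
  proof (rule dependent_nat_choice)
    show "\<exists>G. class_pseudometric ?S (p 0) (fst G) \<and> 0 < snd G \<and> (0 = 0 \<longrightarrow> G = (e0, \<epsilon>))"
      using e0 assms(4) by (intro exI[of _ "(e0, \<epsilon>)"]) simp
    fix G n
    assume G: "class_pseudometric ?S (p n) (fst G) \<and> 0 < snd G \<and> (n = 0 \<longrightarrow> G = (e0, \<epsilon>))"
    have "class_pseudometric ?S (p (Suc n)) (fst G)"
      by (rule class_pseudometric_refine[OF conjunct1[OF G] p_refine[of n "Suc n"]]) simp_all
    from robust_perturbation[OF this conjunct1[OF conjunct2[OF G]] K(1)[of n] p_open[of "Suc n"]
        J[of n]]
    obtain e' t' where "class_pseudometric ?S (p (Suc n)) e'" "0 < t'" "t' \<le> snd G / 2"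
      "\<forall>x\<in>?S. \<forall>y\<in>?S. fst G x y \<le> e' x y \<and> e' x y \<le> fst G x y + snd G / 4 \<and>
        (p (Suc n) x \<noteq> p (Suc n) y \<longrightarrow> fst G x y + snd G / 8 \<le> e' x y)"
      "robustly_independent (K n) (p (Suc n)) (J n) e' t'"
      by (elim exE conjE)
    then show "\<exists>H. (class_pseudometric ?S (p (Suc n)) (fst H) \<and> 0 < snd H \<and> (Suc n = 0 \<longrightarrow> H = (e0, \<epsilon>))) \<and>
      (snd H \<le> snd G / 2 \<and>
       (\<forall>x\<in>?S. \<forall>y\<in>?S. fst G x y \<le> fst H x y \<and> fst H x y \<le> fst G x y + snd G / 4 \<and>
          (p (Suc n) x \<noteq> p (Suc n) y \<longrightarrow> fst G x y + snd G / 8 \<le> fst H x y)) \<and>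
       robustly_independent (K n) (p (Suc n)) (J n) (fst H) (snd H))"
      by (intro exI[of _ "(e', t')"]) simp
  qed
  then obtain F where F: "\<forall>n. (class_pseudometric ?S (p n) (fst (F n)) \<and> 0 < snd (F n) \<and> (n = 0 \<longrightarrow> F n = (e0, \<epsilon>))) \<and>
      (snd (F (Suc n)) \<le> snd (F n) / 2 \<and>
       (\<forall>x\<in>?S. \<forall>y\<in>?S. fst (F n) x y \<le> fst (F (Suc n)) x y \<and>
          fst (F (Suc n)) x y \<le> fst (F n) x y + snd (F n) / 4 \<and>
          (p (Suc n) x \<noteq> p (Suc n) y \<longrightarrow> fst (F n) x y + snd (F n) / 8 \<le> fst (F (Suc n)) x y)) \<and>
       robustly_independent (K n) (p (Suc n)) (J n) (fst (F (Suc n))) (snd (F (Suc n))))" ..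
  define e where "e n = fst (F n)" for n
  define t where "t n = snd (F n)" for n
  have e: "class_pseudometric ?S (p n) (e n)" and t_pos: "0 < t n" and t_half: "t (Suc n) \<le> t n / 2"
    and robust: "robustly_independent (K n) (p (Suc n)) (J n) (e (Suc n)) (t (Suc n))" for n
    using spec[OF F, of n] unfolding e_def t_def by blast+
  have step: "e n x y \<le> e (Suc n) x y \<and> e (Suc n) x y \<le> e n x y + t n / 4"
    and sep: "p (Suc n) x \<noteq> p (Suc n) y \<Longrightarrow> e n x y + t n / 8 \<le> e (Suc n) x y"
    if "x \<in> ?S" "y \<in> ?S" for n x y
    using spec[OF F, of n] that unfolding e_def t_def by blast+
  have e_0: "e 0 = e0" "t 0 = \<epsilon>"
    using spec[OF F, of 0] unfolding e_def t_def by simp_all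
  obtain E where E_out: "\<And>x y. x \<notin> ?S \<or> y \<notin> ?S \<Longrightarrow> E x y = 0"
    and E_lim: "\<And>x y. x \<in> ?S \<Longrightarrow> y \<in> ?S \<Longrightarrow> (\<lambda>n. e n x y) \<longlonglongrightarrow> E x y"
    and E_bounds: "\<And>n x y. x \<in> ?S \<Longrightarrow> y \<in> ?S \<Longrightarrow> e n x y \<le> E x y \<and> E x y \<le> e n x y + t n / 2"
    by (rule converging_pseudometrics[of t ?S e, OF t_pos t_half step]) blast+

  \<comment> \<open>Separation of points by the partitions and the limit\<close>
  have E_sep: "t n / 8 \<le> E x y" if "x \<in> ?S" "y \<in> ?S" "p (Suc n) x \<noteq> p (Suc n) y" for n x y
    using sep[OF that] E_bounds[OF that(1,2), of "Suc n"] class_pseudometricD(1)[OF e that(1,2), of n]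
    by linarith
  have separated: "\<forall>\<^sub>F n in sequentially. p n x \<noteq> p n y" if S: "x \<in> ?S" "y \<in> ?S" "x \<noteq> y" for x y
  proof -
    have "0 < d x y / (\<epsilon> / 4)"
      using S assms(4) by simp
    from eventually_inverse_Suc_le[OF this] show ?thesis
    proof (rule eventually_mono)
      fix n assume "inverse (real (Suc n)) \<le> d x y / (\<epsilon> / 4)"
      then have "\<delta> n \<le> d x y"
        using assms(4) by (simp add: \<delta>_def field_simps)
      then show "p n x \<noteq> p n y"
        using p_small[OF S(1,2), of n] by auto
    qed
  qed
  have separated_either: "\<forall>\<^sub>F n in sequentially. p n a \<noteq> p n b \<or> p n a' \<noteq> p n b'"
    if "a \<in> ?S" "b \<in> ?S" "a' \<in> ?S" "b' \<in> ?S" "a \<noteq> b \<or> a' \<noteq> b'" for a b a' b'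
    using that(5)
  proof
    assume "a \<noteq> b"
    with that(1,2) have "\<forall>\<^sub>F n in sequentially. p n a \<noteq> p n b"
      by (rule separated)
    then show ?thesis
      by (rule eventually_mono) simp
  next
    assume "a' \<noteq> b'"
    with that(3,4) have "\<forall>\<^sub>F n in sequentially. p n a' \<noteq> p n b'"
      by (rule separated)
    then show ?thesis
      by (rule eventually_mono) simp
  qed
  have t_small: "\<exists>n. t n < r" if "0 < r" for r
  proof -
    have t_pow: "t n \<le> \<epsilon> * (1 / 2) ^ n" for n
    proof (induction n)
      case (Suc n)
      then show ?case
        using t_half[of n] by simp
    qed (simp add: e_0)
    have "0 < r / \<epsilon>"
      using that assms(4) by simp
    then obtain n where "(1 / 2) ^ n < r / \<epsilon>"
      using real_arch_pow_inv[of "r / \<epsilon>" "1 / 2"] by auto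
    then have "\<epsilon> * (1 / 2) ^ n < r"
      using assms(4) by (simp add: field_simps)
    then show ?thesis
      using t_pow[of n] by (intro exI[of _ n]) simp
  qed

  \<comment> \<open>The limit is a metric\<close>
  have metric: "Metric_space ?S E"
  proof
    show nonneg: "0 \<le> E x y" for x y
    proof (cases "x \<in> ?S \<and> y \<in> ?S")
      case True
      then show ?thesis
        using E_bounds[of x y 0] class_pseudometricD(1)[OF e, of x y 0] by auto
    qed (use E_out in auto)
    show "E x y = E y x" for x y
    proof (cases "x \<in> ?S \<and> y \<in> ?S")
      case True
      then have "e n x y = e n y x" for n
        by (intro class_pseudometricD(2)[OF e]) simp_all
      then have "(\<lambda>n. e n x y) \<longlonglongrightarrow> E y x"
        using E_lim[of y x] True by simp
      with E_lim[of x y] True show ?thesis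
        by (intro LIMSEQ_unique) simp_all
    qed (use E_out in auto)
    show "E x y = 0 \<longleftrightarrow> x = y" if S: "x \<in> ?S" "y \<in> ?S" for x y
    proof
      assume "x = y"
      then have "e n x y = 0" for n
        by (intro class_pseudometricD(3)[OF e S]) simp
      then show "E x y = 0"
        using LIMSEQ_unique[OF E_lim[OF S], of 0] by simp
    next
      assume 0: "E x y = 0"
      show "x = y"
      proof (rule ccontr)
        assume "x \<noteq> y"
        then have "\<forall>\<^sub>F n in sequentially. p (Suc n) x \<noteq> p (Suc n) y"
          by (intro eventually_sequentially_Suc[THEN iffD2] separated S)
        then obtain n where "p (Suc n) x \<noteq> p (Suc n) y"
          using eventually_happens'[OF sequentially_bot] by blast
        then show False
          using E_sep[OF S, of n] 0 t_pos[of n] by simp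
      qed
    qed
    show "E x z \<le> E x y + E y z" if S: "x \<in> ?S" "y \<in> ?S" "z \<in> ?S" for x y z
    proof (rule LIMSEQ_le)
      show "(\<lambda>n. e n x z) \<longlonglongrightarrow> E x z" "(\<lambda>n. e n x y + e n y z) \<longlonglongrightarrow> E x y + E y z"
        using S by (intro E_lim tendsto_add; simp)+
      show "\<exists>N. \<forall>n\<ge>N. e n x z \<le> e n x y + e n y z"
        using class_pseudometricD(4)[OF e S] by blast
    qed
  qed

  \<comment> \<open>The topology induced by the limit\<close>
  have "Metric_space.mtopology ?S E = X"
  proof (rule mtopology_eqI[OF assms(3) metric])
    fix x and r :: real assume x: "x \<in> ?S" and r: "0 < r"
    have "0 < r / (\<epsilon> / 4)"
      using r assms(4) by simp
    from eventually_happens'[OF sequentially_bot eventually_inverse_Suc_le[OF this]]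
    obtain n where n: "inverse (real (Suc n)) \<le> r / (\<epsilon> / 4)"
      by blast
    \<comment> \<open>The shift is due to \<open>E_sep\<close>: a distance below
      \<open>t n / 8\<close> forces equal classes at stage \<open>Suc n\<close>, where the mesh is
      \<open>\<delta> (Suc n)\<close>.\<close>
    have "inverse (real (Suc (Suc n))) \<le> inverse (real (Suc n))"
      by simp
    with n have "inverse (real (Suc (Suc n))) \<le> r / (\<epsilon> / 4)"
      by linarith
    then have "\<delta> (Suc n) \<le> r"
      using assms(4) by (simp add: \<delta>_def field_simps)
    then have "d x y < r" if "y \<in> ?S" "E x y < t n / 8" for y
      using E_sep[OF x that(1), of n] that(2) p_small[OF x that(1), of "Suc n"] by force
    then show "\<exists>s>0. \<forall>y\<in>?S. E x y < s \<longrightarrow> d x y < r"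
      using t_pos[of n] by (intro exI[of _ "t n / 8"]) auto
    obtain m where m: "t m < r"
      using t_small[OF r] by blast
    \<comment> \<open>On a class of stage \<open>m\<close> the pseudometric \<open>e m\<close> is 0,
      so \<open>E\<close> is at most \<open>t m / 2\<close> there.\<close>
    have "E x y < r" if "y \<in> ?S" "p m y = p m x" for y
      using E_bounds[OF x that(1), of m] class_pseudometricD(3)[OF e x that(1), of m] that(2) m t_pos[of m]
      by simp
    then show "\<exists>U. openin X U \<and> x \<in> U \<and> (\<forall>y\<in>U. E x y < r)"
      using p_open[of m "p m x"] x by (intro exI[of _ "{y \<in> ?S. p m y = p m x}"]) auto
  qed
  then have "E \<in> Met X"
    using metric E_out unfolding Met_def by blast

  \<comment> \<open>Algebraic independence of the limit\<close>
  moreover have "eval_rat_mpoly r P (\<lambda>i. E (x i) (y i)) \<noteq> 0"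
    if xy: "\<forall>i\<in>{1..r}. x i \<in> ?S \<and> y i \<in> ?S \<and> x i \<noteq> y i"
      and inj: "inj_on (\<lambda>i. {x i, y i}) {1..r}" and P: "P \<in> rat_mpolys r" "P \<noteq> 0" for r x y P
  proof -
    \<comment> \<open>Both ways of matching the endpoints have to be excluded, and each is excluded
      at all sufficiently fine stages.\<close>
    have pairs: "\<forall>\<^sub>F n in sequentially. {p n (x i), p n (y i)} \<noteq> {p n (x j), p n (y j)}"
      if ij: "i \<in> {1..r}" "j \<in> {1..r}" "i \<noteq> j" for i j
    proof -
      have "{x i, y i} \<noteq> {x j, y j}"
        using inj_onD[OF inj] ij by blast
      then have "x i \<noteq> x j \<or> y i \<noteq> y j" "x i \<noteq> y j \<or> y i \<noteq> x j"
        by auto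
      then have "\<forall>\<^sub>F n in sequentially. p n (x i) \<noteq> p n (x j) \<or> p n (y i) \<noteq> p n (y j)"
        "\<forall>\<^sub>F n in sequentially. p n (x i) \<noteq> p n (y j) \<or> p n (y i) \<noteq> p n (x j)"
        using bspec[OF xy ij(1)] bspec[OF xy ij(2)] by (intro separated_either; simp)+
      then show ?thesis
        by eventually_elim (auto simp: doubleton_eq_iff)
    qed
    have "\<forall>\<^sub>F n in sequentially. \<forall>i\<in>{1..r}. p n (x i) \<noteq> p n (y i) \<and>
        (\<forall>j\<in>{1..r} - {i}. {p n (x i), p n (y i)} \<noteq> {p n (x j), p n (y j)})"
      using xy pairs by (intro eventually_ball_finite eventually_conj ballI separated) auto
    \<comment> \<open>Stage \<open>n\<close> of the construction protects relations between classes
      of \<open>p (Suc n)\<close>, hence the shift.\<close>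
    then have "\<forall>\<^sub>F n in sequentially. \<forall>i\<in>{1..r}. p (Suc n) (x i) \<noteq> p (Suc n) (y i) \<and>
        (\<forall>j\<in>{1..r} - {i}. {p (Suc n) (x i), p (Suc n) (y i)} \<noteq> {p (Suc n) (x j), p (Suc n) (y j)})"
      by (subst eventually_sequentially_Suc)
    moreover have "\<forall>\<^sub>F n in sequentially. \<forall>i\<in>{1..r}. x i \<in> K n \<and> y i \<in> K n"
      using xy by (intro eventually_ball_finite eventually_conj ballI eventually_mem_exhaustion[OF K(2,3)]) auto
    moreover have "\<forall>\<^sub>F n in sequentially. to_nat (r, P) \<le> n"
      by (rule eventually_ge_at_top)
    ultimately have "\<forall>\<^sub>F n in sequentially. eval_rat_mpoly r P (\<lambda>i. E (x i) (y i)) \<noteq> 0"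
    proof eventually_elim
      case (elim n)
      \<comment> \<open>All changes after stage \<open>Suc n\<close> together amount to at most
        \<open>t (Suc n) / 2\<close>, so \<open>E\<close> is within the tolerance of that
        stage.\<close>
      have "\<forall>a\<in>K n. \<forall>b\<in>K n. \<bar>e (Suc n) a b - E a b\<bar> \<le> t (Suc n)"
      proof (intro ballI)
        fix a b assume "a \<in> K n" "b \<in> K n"
        then have "a \<in> ?S" "b \<in> ?S"
          using K(3) by blast+
        then show "\<bar>e (Suc n) a b - E a b\<bar> \<le> t (Suc n)"
          using E_bounds[of a b "Suc n"] t_pos[of "Suc n"] by (simp add: abs_le_iff)
      qed
      moreover have "(r, P) \<in> J n"
        unfolding J_def using P elim(3) by (auto intro: image_eqI[of _ _ "to_nat (r, P)"])
      moreover have "\<forall>i\<in>{1..r}. x i \<in> K n \<and> y i \<in> K n \<and> p (Suc n) (x i) \<noteq> p (Suc n) (y i)"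
        using elim(1,2) by blast
      moreover have "inj_on (\<lambda>i. {p (Suc n) (x i), p (Suc n) (y i)}) {1..r}"
        using elim(1) by (intro inj_onI) blast
      ultimately show ?case
        using robust[of n] unfolding robustly_independent_def by blast
    qed
    then show ?thesis
      using eventually_happens'[OF sequentially_bot] by blast
  qed
  ultimately have "E \<in> Met_alg_indep X"
    unfolding Met_alg_indep_def alg_indep_distances_def by simp
  \<comment> \<open>Half of \<epsilon> is spent on representatives and half on the perturbations, as
    \<open>t 0 = \<epsilon>\<close>.\<close>
  moreover have "\<bar>d x y - E x y\<bar> \<le> \<epsilon>" if "x \<in> ?S" "y \<in> ?S" for x y
    using e0_close[OF that] E_bounds[OF that, of 0] unfolding e_0 by linarith
  ultimately show ?thesis
    by blast
qed

theorem theorem1p3: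
  fixes X :: "'a topology"
  assumes "metrizable_space X" and "sigma_compact_space X"
  shows "gdelta_in (Met_topology X) (Met_alg_indep X) \<and>
         (strongly_zero_dimensional X \<longrightarrow>
            Met_topology X closure_of Met_alg_indep X = topspace (Met_topology X))"
proof (intro conjI impI)
  show "gdelta_in (Met_topology X) (Met_alg_indep X)"
    using assms(2) by (rule gdelta_in_Met_alg_indep)
  assume "strongly_zero_dimensional X"
  interpret M: Metric_space "Met X" "capped_sup_dist X"
    by (rule Metric_space_Met)
  have "\<exists>e\<in>Met_alg_indep X. e \<in> M.mball d r" if d: "d \<in> Met X" and r: "0 < r" for d r
  proof -
    \<comment> \<open>The bounds on pairs of points give only a weak inequality for the supremum;
      half the radius makes it strict.\<close>
    have "0 < r / 2"
      using r by simp
    then obtain e where e: "e \<in> Met_alg_indep X"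
      "\<forall>x\<in>topspace X. \<forall>y\<in>topspace X. \<bar>d x y - e x y\<bar> \<le> r / 2"
      using dense_Met_alg_indep[OF \<open>strongly_zero_dimensional X\<close> assms(2) d] by blast
    then have "capped_sup_dist X d e \<le> r / 2"
      using r by (intro capped_sup_dist_le) auto
    then show ?thesis
      using e(1) d r by (intro bexI[of _ e]) (auto simp: Met_alg_indep_def)
  qed
  then show "Met_topology X closure_of Met_alg_indep X = topspace (Met_topology X)"
    unfolding Met_topology_def M.metric_closure_of M.topspace_mtopology by blast
qed

end
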